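(* Let $k\ge2$ and let $(\mathbf w,\mathcal B,\mathbf x)$ be a reduced representation of a nonnegative $k$-regular sequence $g$. Then the unique ghost measure $\mu_g$ of $g$ satisfies $$\mu_g=\mathbf w^T(\mathbf B-\mathbf B_0)\big(\delta_{1/(k-1)}\big)*\Big(\mathop{\ast}_{n=1}^{\infty}\widehat{\mathbf B}\big(\delta_{1/(k^n(k-1))}\big)\Big)\,\mathbf x ,$$ where the infinite convolution product exists as the weak (entrywise) limit as $N\to\infty$ of the matrix-valued finite convolution products $\widehat{\mathbf B}(\delta_{1/(k(k-1))})*\widehat{\mathbf B}(\delta_{1/(k^2(k-1))})*\cdots*\widehat{\mathbf B}(\delta_{1/(k^N(k-1))})$.
   Context: Fix an integer $k\ge2$. For $n\ge1$ let $(n)_k=i_s\cdots i_0$ be the base-$k$ expansion ($i_s\ne0$), and for matrices $\mathbf B_0,\dots,\mathbf B_{k-1}$ put $\mathbf B_{(n)_k}=\mathbf B_{i_s}\cdots\mathbf B_{i_0}$, $\mathbf B_{(0)_k}=$ identity. A linear representation of degree $d$ of a real sequence $g$ is a tuple $(\mathbf w,\mathcal B,\mathbf x)$ with $\mathbf w,\mathbf x\in\mathbb R^d$, $\mathcal B=\{\mathbf B_0,\dots,\mathbf B_{k-1}\}\subset\mathbb R^{d\times d}$, and $g(n)=\mathbf w^T\mathbf B_{(n)_k}\mathbf x$ for all $n\ge0$; sequences with such a representation are $k$-regular. Put $\mathbf B=\sum_i\mathbf B_i$. For nonnegative $g$ put $\Sigma_g(N)=\sum_{m=k^N}^{k^{N+1}-1}g(m)$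 and, when $\Sigma_g(N)\ne0$, $\mu_N=\frac1{\Sigma_g(N)}\sum_{m=0}^{k^{N+1}-k^N-1}g(k^N+m)\,\delta_{m/(k^N(k-1))}$, a probability measure on $\mathbb T=[0,1)$ with addition mod 1. Ghost measures of $g$ are the weak accumulation points of $(\mu_N)_N$. Let $V\subset\mathbb R^d$ be the subspace with $V^T=\mathrm{span}\{\mathbf w^T\mathbf B_{(n)_k}:n\ge1\}$, $\mathbf P_V$ the orthogonal projection onto $V$, $\widetilde{\mathbf B}_i=\mathbf P_V\mathbf B_i\mathbf P_V$, $\widetilde{\mathbf B}=\mathbf P_V\mathbf B\mathbf P_V$. The tuple $(\mathbf w,\mathcal B,\mathbf x)$ is a reduced representation of the nonnegative sequence $g$ if: (i) the spectral radius $\rho=\rho(\widetilde{\mathbf B})$ (with $\rho>0$) is an eigenvalue of $\widetilde{\mathbf B}$ and the only one of modulus $\rho$; (ii) $\mathbf x$ is a $\rho$-eigenvector of $\widetilde{\mathbf B}$; (iii) $\Sigma_g(n)=\rho^n$ for all $n\in\mathbb N$; (iv) $g$ has a unique ghost measure $\mu_g$. Let $\widehat V=\mathrm{span}\{\widetilde{\mathbf B}_0^n\widetilde{\mathbf B}_{(m)_k}\mathbf x:m,n\ge0\}$ (with $\widetilde{\mathbf B}_{(0)_k}$ the identity), $\mathbf P_{\widehat V}$ the orthogonal projection onto $\widehat V$, $\widehat{\mathbf B}_i=\mathbf P_{\widehat V}\widetilde{\mathbf B}_i\mathbf P_{\widehat V}$. Define the matrix polynomials $\widehat{\mathbf B}(z)=\frac1\rho\sum_{j=0}^{k-1}\widehat{\mathbf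 B}_jz^j$ and $(\mathbf B-\mathbf B_0)(z)=\sum_{j=1}^{k-1}\mathbf B_jz^{j-1}$. These are evaluated at Dirac measures on $\mathbb T$ by interpreting powers as convolution powers: $\delta_x^j=\delta_{jx}$, $\delta_x^0=\delta_0$; the results are matrix-valued measures, convolved using matrix multiplication. *)

theory Defs
  imports "HOL-Analysis.Analysis" "HOL-Probability.Probability"
    "HOL-Computational_Algebra.Polynomial"
begin

section \<open>Linear representations\<close>

text \<open>Most significant digit first; the expansion of 0 is the empty word. The guard on the base
  only serves termination.\<close>

function base_digits :: "nat \<Rightarrow> nat \<Rightarrow> nat list" where
  "base_digits k n = (if n = 0 \<or> k < 2 then [] else base_digits k (n div k) @ [n mod k])"
  by pat_completeness auto
termination by (relation "Wellfounded.measure snd") auto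

declare base_digits.simps [simp del]

definition mat_word :: "(nat \<Rightarrow> real^'d^'d) \<Rightarrow> nat list \<Rightarrow> real^'d^'d" where
  "mat_word B ds = foldr (\<lambda>i M. B i ** M) ds (mat 1)"

definition mat_digits :: "nat \<Rightarrow> (nat \<Rightarrow> real^'d^'d) \<Rightarrow> nat \<Rightarrow> real^'d^'d" where
  "mat_digits k B n = mat_word B (base_digits k n)"

text \<open>A family of matrices is a function on the naturals of which only the values at indices
  below \<open>k\<close> are relevant.\<close>

definition linear_representation ::
    "nat \<Rightarrow> real^'d \<Rightarrow> (nat \<Rightarrow> real^'d^'d) \<Rightarrow> real^'d \<Rightarrow> (nat \<Rightarrow> real) \<Rightarrow> bool" where
  "linear_representation k w B x g \<longleftrightarrow> (\<forall>n. g n = w \<bullet> (mat_digits k B n *v x))"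

definition block_sum :: "nat \<Rightarrow> (nat \<Rightarrow> real) \<Rightarrow> nat \<Rightarrow> real" where
  "block_sum k g N = (\<Sum>m = k^N..<k^(N+1). g m)"


section \<open>Measures on the torus\<close>

text \<open>The torus is the set \<open>{0..<1}\<close> with addition modulo 1. Its topology is that of the
  circle, whose Borel sets are the Borel subsets of the interval.\<close>

definition torus :: "real measure" where
  "torus = restrict_space borel {0..<1}"

text \<open>Continuous functions on the torus, as 1-periodic continuous functions on the line.\<close>

definition torus_continuous :: "(real \<Rightarrow> real) \<Rightarrow> bool" where
  "torus_continuous f \<longleftrightarrow> continuous_on UNIV f \<and> (\<forall>x. f (x + 1) = f x)"

definition ghost_approx :: "nat \<Rightarrow> (nat \<Rightarrow> real) \<Rightarrow> nat \<Rightarrow> real measure" where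
  "ghost_approx k g N =
     distr (point_measure {..<k^(N+1) - k^N} (\<lambda>m. ennreal (g (k^N + m) / block_sum k g N)))
       torus (\<lambda>m. real m / (real k ^ N * (real k - 1)))"

text \<open>Accumulation points of the sequence in the weak topology: the sequence is frequently in
  every basic neighbourhood, given by finitely many test functions and an \<open>\<epsilon>\<close>. Only indices
  with nonvanishing \<open>block_sum\<close> count, as the other approximants are undefined.\<close>

definition ghost_measure :: "nat \<Rightarrow> (nat \<Rightarrow> real) \<Rightarrow> real measure \<Rightarrow> bool" where
  "ghost_measure k g \<mu> \<longleftrightarrow>
     prob_space \<mu> \<and> sets \<mu> = sets torus \<and>
     (\<forall>F \<epsilon>. finite F \<and> (\<forall>f\<in>F. torus_continuous f) \<and> \<epsilon> > 0 \<longrightarrow>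
        (\<exists>\<^sub>F N in sequentially. block_sum k g N \<noteq> 0 \<and>
           (\<forall>f\<in>F. \<bar>(\<integral>t. f t \<partial>ghost_approx k g N) - (\<integral>t. f t \<partial>\<mu>)\<bar> < \<epsilon>)))"


section \<open>Reduced representations\<close>

definition orth_proj :: "(real^'d) set \<Rightarrow> real^'d^'d" where
  "orth_proj V = (THE P. \<forall>y. P *v y \<in> V \<and> (\<forall>v\<in>V. orthogonal (y - P *v y) v))"

lemma ex1_orth_proj:
  fixes V :: "(real^'d) set"
  assumes "subspace V"
  shows "\<exists>!P. \<forall>y. P *v y \<in> V \<and> (\<forall>v\<in>V. orthogonal (y - P *v y) v)"
proof -
  have "\<exists>p. p \<in> V \<and> (\<forall>v\<in>V. orthogonal (y - p) v)" for y
  proof -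
    obtain p z where pz: "p \<in> span V" "\<And>v. v \<in> span V \<Longrightarrow> orthogonal z v" "y = p + z"
      using orthogonal_subspace_decomp_exists by metis
    moreover have "span V = V" using assms by (simp add: span_eq_iff)
    ultimately show ?thesis
      by (intro exI[of _ p]) simp
  qed
  then obtain p where p: "\<And>y. p y \<in> V" "\<And>y v. v \<in> V \<Longrightarrow> orthogonal (y - p y) v"
    by metis
  have uniq: "q = p y" if q: "q \<in> V" "\<forall>v\<in>V. orthogonal (y - q) v" for q y
  proof -
    have "q - p y \<in> V" using p(1) q(1) assms by (rule_tac subspace_diff) auto
    then have "orthogonal (y - p y) (q - p y)" "orthogonal (y - q) (q - p y)"
      using p(2) q(2) by auto
    then have "(q - p y) \<bullet> (q - p y) = 0"
      unfolding orthogonal_def by (simp add: inner_diff_left inner_diff_right)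
    then show ?thesis by simp
  qed
  have lin: "linear p"
  proof (rule linearI)
    fix x y
    show "p (x + y) = p x + p y"
    proof (rule uniq[symmetric])
      show "p x + p y \<in> V" using p(1) assms by (simp add: subspace_add)
      show "\<forall>v\<in>V. orthogonal (x + y - (p x + p y)) v"
        using p(2)[of _ x] p(2)[of _ y] unfolding orthogonal_def
        by (simp add: inner_diff_left inner_add_left)
    qed
  next
    fix c x
    show "p (c *\<^sub>R x) = c *\<^sub>R p x"
    proof (rule uniq[symmetric])
      show "c *\<^sub>R p x \<in> V" using p(1) assms by (simp add: subspace_scale)
      show "\<forall>v\<in>V. orthogonal (c *\<^sub>R x - c *\<^sub>R p x) v"
        using p(2)[of _ x] unfolding orthogonal_def
        by (simp add: inner_diff_left)
    qed
  qed
  show ?thesis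
  proof (rule ex1I[of _ "matrix p"])
    show "\<forall>y. matrix p *v y \<in> V \<and> (\<forall>v\<in>V. orthogonal (y - matrix p *v y) v)"
      using p lin by (simp add: matrix_works)
  next
    fix Q assume "\<forall>y. Q *v y \<in> V \<and> (\<forall>v\<in>V. orthogonal (y - Q *v y) v)"
    then have "Q *v y = matrix p *v y" for y
      using uniq lin by (simp add: matrix_works)
    then show "Q = matrix p" by (simp add: matrix_eq)
  qed
qed

definition eigenvalues :: "real^'d^'d \<Rightarrow> complex set" where
  "eigenvalues A =
     {z. \<exists>v :: complex^'d. v \<noteq> 0 \<and> map_matrix complex_of_real A *v v = z *s v}"

definition spectral_radius :: "real^'d^'d \<Rightarrow> real" where
  "spectral_radius A = Max (cmod ` eigenvalues A)"

definition row_space :: "nat \<Rightarrow> real^'d \<Rightarrow> (nat \<Rightarrow> real^'d^'d) \<Rightarrow> (real^'d) set" where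
  "row_space k w B = span {w v* mat_digits k B n |n. n \<ge> 1}"

definition compress :: "(real^'d) set \<Rightarrow> real^'d^'d \<Rightarrow> real^'d^'d" where
  "compress V A = orth_proj V ** A ** orth_proj V"

definition B_tilde :: "nat \<Rightarrow> real^'d \<Rightarrow> (nat \<Rightarrow> real^'d^'d) \<Rightarrow> nat \<Rightarrow> real^'d^'d" where
  "B_tilde k w B i = compress (row_space k w B) (B i)"

definition B_tilde_sum :: "nat \<Rightarrow> real^'d \<Rightarrow> (nat \<Rightarrow> real^'d^'d) \<Rightarrow> real^'d^'d" where
  "B_tilde_sum k w B = compress (row_space k w B) (\<Sum>i<k. B i)"

definition growth :: "nat \<Rightarrow> real^'d \<Rightarrow> (nat \<Rightarrow> real^'d^'d) \<Rightarrow> real" where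
  "growth k w B = spectral_radius (B_tilde_sum k w B)"

definition reduced_representation ::
    "nat \<Rightarrow> real^'d \<Rightarrow> (nat \<Rightarrow> real^'d^'d) \<Rightarrow> real^'d \<Rightarrow> (nat \<Rightarrow> real) \<Rightarrow> bool" where
  "reduced_representation k w B x g \<longleftrightarrow>
     linear_representation k w B x g \<and> (\<forall>n. g n \<ge> 0) \<and>
     (let \<rho> = growth k w B; E = eigenvalues (B_tilde_sum k w B) in
        \<rho> > 0 \<and>
        complex_of_real \<rho> \<in> E \<and> (\<forall>z\<in>E. cmod z = \<rho> \<longrightarrow> z = complex_of_real \<rho>) \<and>
        x \<noteq> 0 \<and> B_tilde_sum k w B *v x = \<rho> *\<^sub>R x \<and>
        (\<forall>n. block_sum k g n = \<rho> ^ n)) \<and>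
     (\<exists>!\<mu>. ghost_measure k g \<mu>)"

definition V_hat :: "nat \<Rightarrow> real^'d \<Rightarrow> (nat \<Rightarrow> real^'d^'d) \<Rightarrow> real^'d \<Rightarrow> (real^'d) set" where
  "V_hat k w B x =
     span {((*v) (B_tilde k w B 0) ^^ n) (mat_digits k (B_tilde k w B) m *v x) |m n. True}"

definition B_hat :: "nat \<Rightarrow> real^'d \<Rightarrow> (nat \<Rightarrow> real^'d^'d) \<Rightarrow> real^'d \<Rightarrow> nat \<Rightarrow> real^'d^'d" where
  "B_hat k w B x i = compress (V_hat k w B x) (B_tilde k w B i)"


section \<open>Signed and matrix-valued measures\<close>

text \<open>Finite signed measures and matrix-valued measures on the torus are countably additive set
  functions. Their values outside of the Borel sets are irrelevant.\<close>

definition torus_vector_measure :: "(real set \<Rightarrow> 'a::real_normed_vector) \<Rightarrow> bool" where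
  "torus_vector_measure \<nu> \<longleftrightarrow>
     (\<forall>A :: nat \<Rightarrow> real set. range A \<subseteq> sets torus \<and> disjoint_family A \<longrightarrow>
        (\<lambda>i. \<nu> (A i)) sums \<nu> (\<Union>i. A i))"

text \<open>Every finite signed measure is a difference of two finite measures (Jordan decomposition);
  for bounded measurable integrands the value does not depend on the choice of the two.\<close>

definition signed_integral :: "(real set \<Rightarrow> real) \<Rightarrow> (real \<Rightarrow> real) \<Rightarrow> real" where
  "signed_integral \<nu> f =
     (THE r. \<exists>M N. finite_measure M \<and> finite_measure N \<and> sets M = sets torus \<and> sets N = sets torus \<and>
        (\<forall>A\<in>sets torus. \<nu> A = measure M A - measure N A) \<and>
        r = (\<integral>t. f t \<partial>M) - (\<integral>t. f t \<partial>N))"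

lemma signed_integral_unique_aux:
  fixes f :: "real \<Rightarrow> real"
  assumes fin: "finite_measure M" "finite_measure N" "finite_measure M'" "finite_measure N'"
    and sets: "sets M = sets torus" "sets N = sets torus" "sets M' = sets torus" "sets N' = sets torus"
    and eq: "\<And>A. A \<in> sets torus \<Longrightarrow> measure M A - measure N A = measure M' A - measure N' A"
    and f: "f \<in> borel_measurable torus" and bdd: "\<And>t. t \<in> {0..<1} \<Longrightarrow> \<bar>f t\<bar> \<le> C"
  shows "(\<integral>t. f t \<partial>M) - (\<integral>t. f t \<partial>N) = (\<integral>t. f t \<partial>M') - (\<integral>t. f t \<partial>N')"
proof -
  interpret M: finite_measure M by fact
  interpret N: finite_measure N by fact
  interpret M': finite_measure M' by fact
  interpret N': finite_measure N' by fact
  have emeq: "emeasure M A + emeasure N' A = emeasure M' A + emeasure N A" if "A \<in> sets torus" for A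
  proof -
    have "measure M A + measure N' A = measure M' A + measure N A"
      using eq[OF that] by simp
    then show ?thesis
      by (simp add: M.emeasure_eq_measure N.emeasure_eq_measure M'.emeasure_eq_measure
          N'.emeasure_eq_measure flip: ennreal_plus)
  qed
  note [measurable_cong] = sets
  have nn: "(\<integral>\<^sup>+t. u t \<partial>M) + (\<integral>\<^sup>+t. u t \<partial>N') = (\<integral>\<^sup>+t. u t \<partial>M') + (\<integral>\<^sup>+t. u t \<partial>N)"
    if "u \<in> borel_measurable torus" for u
    using that
  proof (induction rule: borel_measurable_induct)
    case (cong u v)
    note sp = sets[THEN sets_eq_imp_space_eq]
    have "(\<integral>\<^sup>+t. u t \<partial>K) = (\<integral>\<^sup>+t. v t \<partial>K)" if "space K = space torus" for K
      using cong(3) that by (intro nn_integral_cong) auto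
    then show ?case using cong(4) sp by simp
  next
    case (set A)
    then show ?case using emeq sets by simp
  next
    case (mult u c)
    then show ?case
      by (simp add: nn_integral_cmult flip: distrib_left)
  next
    case (add u v)
    have "(\<integral>\<^sup>+t. v t + u t \<partial>M) + (\<integral>\<^sup>+t. v t + u t \<partial>N') =
        ((\<integral>\<^sup>+t. v t \<partial>M) + (\<integral>\<^sup>+t. v t \<partial>N')) + ((\<integral>\<^sup>+t. u t \<partial>M) + (\<integral>\<^sup>+t. u t \<partial>N'))"
      using add.hyps by (simp add: nn_integral_add ac_simps)
    also have "\<dots> = ((\<integral>\<^sup>+t. v t \<partial>M') + (\<integral>\<^sup>+t. v t \<partial>N)) + ((\<integral>\<^sup>+t. u t \<partial>M') + (\<integral>\<^sup>+t. u t \<partial>N))"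
      using add.IH by simp
    also have "\<dots> = (\<integral>\<^sup>+t. v t + u t \<partial>M') + (\<integral>\<^sup>+t. v t + u t \<partial>N)"
      using add.hyps by (simp add: nn_integral_add ac_simps)
    finally show ?case .
  next
    case (seq U)
    have mono: "(\<integral>\<^sup>+t. (SUP i. U i) t \<partial>K) = (SUP i. \<integral>\<^sup>+t. U i t \<partial>K)" if "sets K = sets torus" for K
    proof -
      have "U i \<in> borel_measurable K" for i
        using seq.hyps(1) by (simp add: measurable_cong_sets[OF that refl])
      then show ?thesis
        using nn_integral_monotone_convergence_SUP[of U K] seq.hyps(3) by (simp add: image_comp)
    qed
    have inc: "incseq (\<lambda>i. \<integral>\<^sup>+t. U i t \<partial>K)" for K
      using seq.hyps(3) by (auto simp: incseq_def le_fun_def intro!: nn_integral_mono)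
    show ?case
      unfolding mono[OF sets(1)] mono[OF sets(2)] mono[OF sets(3)] mono[OF sets(4)]
      unfolding ennreal_SUP_add[OF inc inc, symmetric] seq.IH ..
  qed
  have spt: "space K = {0..<1}" if "sets K = sets torus" for K
    using sets_eq_imp_space_eq[OF that] by (simp add: torus_def space_restrict_space)
  note sp = spt[OF sets(1)] spt[OF sets(2)] spt[OF sets(3)] spt[OF sets(4)]
  have real: "integrable K f \<and> (\<integral>t. f t \<partial>K) = enn2real (\<integral>\<^sup>+t. ennreal (f t + C) \<partial>K) - C * measure K (space K)
      \<and> (\<integral>\<^sup>+t. ennreal (f t + C) \<partial>K) < \<infinity>"
    if K: "finite_measure K" "sets K = sets torus" for K
  proof -
    interpret K: finite_measure K by fact
    note spK = spt[OF K(2)]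
    have fK: "f \<in> borel_measurable K" using f by (simp add: measurable_cong_sets[OF K(2) refl])
    have int: "integrable K f"
      using bdd spK by (intro K.integrable_const_bound[of _ C] fK) (auto intro!: AE_I2)
    have int': "integrable K (\<lambda>t. f t + C)" using int by simp
    have nonneg: "AE t in K. 0 \<le> f t + C"
      using bdd spK by (intro AE_I2) (force simp: abs_le_iff)
    have e: "(\<integral>\<^sup>+t. ennreal (f t + C) \<partial>K) = ennreal (\<integral>t. f t + C \<partial>K)"
      using nn_integral_eq_integral[OF int' nonneg] .
    have "(\<integral>t. f t + C \<partial>K) \<ge> 0" using nonneg by (rule integral_nonneg_AE)
    then show ?thesis using e int by simp
  qed
  note r = real[OF fin(1) sets(1)] real[OF fin(2) sets(2)] real[OF fin(3) sets(3)] real[OF fin(4) sets(4)]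
  have "(\<lambda>t. ennreal (f t + C)) \<in> borel_measurable torus" using f by measurable
  from nn[OF this] have
    "enn2real (\<integral>\<^sup>+t. ennreal (f t + C) \<partial>M) + enn2real (\<integral>\<^sup>+t. ennreal (f t + C) \<partial>N') =
     enn2real (\<integral>\<^sup>+t. ennreal (f t + C) \<partial>M') + enn2real (\<integral>\<^sup>+t. ennreal (f t + C) \<partial>N)"
    using r by (metis enn2real_plus infinity_ennreal_def)
  moreover have "measure M {0..<1} + measure N' {0..<1} = measure M' {0..<1} + measure N {0..<1}"
    using eq[OF sets.top] by (simp add: spt)
  then have "C * measure M (space M) + C * measure N' (space N') =
      C * measure M' (space M') + C * measure N (space N)"
    by (simp add: sp flip: distrib_left)
  ultimately show ?thesis using r by linarith
qed

lemma signed_integral_eq: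
  assumes "finite_measure M" "finite_measure N" "sets M = sets torus" "sets N = sets torus"
    and "\<And>A. A \<in> sets torus \<Longrightarrow> \<nu> A = measure M A - measure N A"
    and "f \<in> borel_measurable torus" "\<And>t. t \<in> {0..<1} \<Longrightarrow> \<bar>f t\<bar> \<le> C"
  shows "signed_integral \<nu> f = (\<integral>t. f t \<partial>M) - (\<integral>t. f t \<partial>N)"
  unfolding signed_integral_def
proof (rule the_equality)
  show "\<exists>M' N'. finite_measure M' \<and> finite_measure N' \<and> sets M' = sets torus \<and> sets N' = sets torus \<and>
      (\<forall>A\<in>sets torus. \<nu> A = measure M' A - measure N' A) \<and>
      (\<integral>t. f t \<partial>M) - (\<integral>t. f t \<partial>N) = (\<integral>t. f t \<partial>M') - (\<integral>t. f t \<partial>N')"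
    using assms by blast
next
  fix r assume "\<exists>M' N'. finite_measure M' \<and> finite_measure N' \<and> sets M' = sets torus \<and> sets N' = sets torus \<and>
      (\<forall>A\<in>sets torus. \<nu> A = measure M' A - measure N' A) \<and>
      r = (\<integral>t. f t \<partial>M') - (\<integral>t. f t \<partial>N')"
  then obtain M' N' where *: "finite_measure M'" "finite_measure N'" "sets M' = sets torus"
    "sets N' = sets torus" "\<forall>A\<in>sets torus. \<nu> A = measure M' A - measure N' A"
    "r = (\<integral>t. f t \<partial>M') - (\<integral>t. f t \<partial>N')" by blast
  show "r = (\<integral>t. f t \<partial>M) - (\<integral>t. f t \<partial>N)"
    unfolding *(6) using * assms
    by (intro signed_integral_unique_aux[where C = C]) auto
qed

definition torus_dirac :: "real \<Rightarrow> real set \<Rightarrow> real" where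
  "torus_dirac x A = indicator A (frac x)"

definition torus_conv :: "(real set \<Rightarrow> real) \<Rightarrow> (real set \<Rightarrow> real) \<Rightarrow> real set \<Rightarrow> real" where
  "torus_conv \<mu> \<nu> A = signed_integral \<nu> (\<lambda>y. \<mu> {x \<in> {0..<1}. frac (x + y) \<in> A})"

primrec torus_conv_power :: "(real set \<Rightarrow> real) \<Rightarrow> nat \<Rightarrow> real set \<Rightarrow> real" where
  "torus_conv_power \<mu> 0 = torus_dirac 0"
| "torus_conv_power \<mu> (Suc j) = torus_conv (torus_conv_power \<mu> j) \<mu>"

type_synonym 'd matrix_measure = "real set \<Rightarrow> real^'d^'d"

definition entry :: "('d::finite) matrix_measure \<Rightarrow> 'd \<Rightarrow> 'd \<Rightarrow> real set \<Rightarrow> real" where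
  "entry \<Phi> i j A = \<Phi> A $ i $ j"

definition matrix_conv ::
    "('d::finite) matrix_measure \<Rightarrow> 'd matrix_measure \<Rightarrow> 'd matrix_measure" where
  "matrix_conv \<Phi> \<Psi> A = (\<chi> i j. \<Sum>l\<in>UNIV. torus_conv (entry \<Phi> i l) (entry \<Psi> l j) A)"

text \<open>Matrix polynomials are only used through their coefficients, since the multiplication that
  the type class provides on \<open>real^'d^'d\<close> is componentwise.\<close>

definition poly_at_measure ::
    "(real^'d^'d) poly \<Rightarrow> (real set \<Rightarrow> real) \<Rightarrow> ('d::finite) matrix_measure" where
  "poly_at_measure p \<mu> A = (\<Sum>j\<le>degree p. torus_conv_power \<mu> j A *\<^sub>R coeff p j)"

primrec matrix_conv_prod :: "(nat \<Rightarrow> ('d::finite) matrix_measure) \<Rightarrow> nat \<Rightarrow> 'd matrix_measure" where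
  "matrix_conv_prod \<Phi> 0 = (\<lambda>A. torus_dirac 0 A *\<^sub>R mat 1)"
| "matrix_conv_prod \<Phi> (Suc N) = matrix_conv (matrix_conv_prod \<Phi> N) (\<Phi> (Suc N))"

definition matrix_weak_limit :: "(nat \<Rightarrow> ('d::finite) matrix_measure) \<Rightarrow> 'd matrix_measure \<Rightarrow> bool" where
  "matrix_weak_limit \<Phi> \<Lambda> \<longleftrightarrow>
     (\<forall>i j f. torus_continuous f \<longrightarrow>
        (\<lambda>N. signed_integral (entry (\<Phi> N) i j) f) \<longlonglongrightarrow> signed_integral (entry \<Lambda> i j) f)"

lemma torus_conv_power_dirac:
  assumes "A \<in> sets torus"
  shows "torus_conv_power (torus_dirac x) j A = torus_dirac (real j * x) A"
  using assms
proof (induction j arbitrary: A)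
  case 0
  then show ?case by simp
next
  case (Suc j)
  define f where "f = (\<lambda>y. torus_conv_power (torus_dirac x) j {s \<in> {0..<1}. frac (s + y) \<in> A})"
  have A: "A \<in> sets borel" "A \<subseteq> {0..<1}"
    using Suc.prems by (auto simp: torus_def sets_restrict_space)
  have [measurable]: "(frac :: real \<Rightarrow> real) \<in> borel_measurable borel"
    unfolding frac_def by simp
  have *: "{s \<in> {0..<1}. frac (s + y) \<in> A} \<in> sets torus" for y :: real
  proof -
    have "{s \<in> {0..<1}. frac (s + y) \<in> A} = {0..<1} \<inter> ((\<lambda>s. frac (s + y)) -` A \<inter> space borel)"
      by auto
    moreover have "(\<lambda>s. frac (s + y)) -` A \<inter> space borel \<in> sets borel"
      using A(1) by (intro measurable_sets[of _ borel borel A]) simp_all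
    ultimately show ?thesis
      unfolding torus_def by (subst sets_restrict_space) auto
  qed
  have ff: "f y = indicator A (frac (frac (real j * x) + y))" for y
    unfolding f_def Suc.IH[OF *] torus_dirac_def
    by (auto simp: indicator_def frac_lt_1)
  have fm: "f \<in> borel_measurable torus"
    unfolding ff[abs_def] torus_def
    by (intro measurable_restrict_space1 measurable_compose[OF _ borel_measurable_indicator[OF A(1)]])
      measurable
  have fr: "frac x \<in> space torus" by (simp add: torus_def space_restrict_space frac_lt_1)
  have fm0: "finite_measure (null_measure torus)"
    by (rule finite_measureI) simp
  have "signed_integral (torus_dirac x) f =
      (\<integral>t. f t \<partial>return torus (frac x)) - (\<integral>t. f t \<partial>null_measure torus)"
  proof (rule signed_integral_eq[where C = 1])
    show "finite_measure (return torus (frac x))"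
      using prob_space_return[OF fr] by (simp add: prob_space.finite_measure)
    show "torus_dirac x A = measure (return torus (frac x)) A - measure (null_measure torus) A"
      if "A \<in> sets torus" for A
      using that by (simp add: torus_dirac_def measure_return)
    show "\<bar>f t\<bar> \<le> 1" for t by (simp add: ff indicator_def)
  qed (use fm fm0 in auto)
  also have "\<dots> = f (frac x)"
    using fm fr by (simp add: integral_return integral_null_measure)
  also have "\<dots> = torus_dirac (real (Suc j) * x) A"
  proof -
    have "frac (frac (real j * x) + frac x) = frac (real j * x + x)"
      by (simp add: frac_unique_iff frac_lt_1)
    then show ?thesis by (simp add: ff torus_dirac_def algebra_simps)
  qed
  finally show ?case by (simp add: torus_conv_def f_def)
qed


section \<open>The matrix polynomials\<close>

definition B_hat_poly ::
    "nat \<Rightarrow> real^'d \<Rightarrow> (nat \<Rightarrow> real^'d^'d) \<Rightarrow> real^'d \<Rightarrow> (real^'d^'d) poly" where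
  "B_hat_poly k w B x = (\<Sum>j<k. monom ((1 / growth k w B) *\<^sub>R B_hat k w B x j) j)"

definition B_diff_poly :: "nat \<Rightarrow> (nat \<Rightarrow> real^'d^'d) \<Rightarrow> (real^'d^'d) poly" where
  "B_diff_poly k B = (\<Sum>j = 1..<k. monom (B j) (j - 1))"

end

theory Submission
  imports Defs "HOL-Computational_Algebra.Fundamental_Theorem_Algebra"
begin

text \<open>The \<open>N\<close>-th finite product is \<open>F\<^sub>N = \<rho>\<^bsup>-N\<^esup> \<Sum> B\<^sub>l \<delta>(l / (k\<^sup>N (k - 1)))\<close>, the sum ranging over all
  words \<open>l\<close> of \<open>N\<close> digits, where \<open>B\<^sub>l\<close> is the corresponding product of compressed matrices.
  Multiplied by \<open>w\<^sup>T (B - B\<^sub>0)(\<delta>)\<close> on the left and by \<open>x\<close> on the right it is exactly the \<open>N\<close>-th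
  approximant of the ghost measure, so it remains to see that \<open>F\<^sub>N\<close> converges weakly.

  By bilinearity it suffices to consider \<open>u\<^sup>T F\<^sub>N v\<close> for \<open>u\<close> and \<open>v\<close> from the spanning sets that define the
  row space and \<open>V_hat\<close>. Then the weights are values of \<open>g\<close> at integers with prescribed leading and
  trailing digits; hence they are nonnegative and, as the block sums of \<open>g\<close> are \<open>\<rho>\<^sup>n\<close>, of bounded total
  mass. Refining a word of length \<open>N\<close> moves its atom by at most \<open>k\<^bsup>-N\<^esup>\<close>, while the mass of its
  refinements is governed by \<open>\<rho>\<^bsup>-L\<^esup> B\<^sup>L v\<close>. These vectors are bounded by the same argument, and since \<open>\<rho>\<close> is
  the only eigenvalue of maximal modulus they converge. So the integrals of a continuous function form
  a Cauchy sequence, and Helly's theorem provides the limit measure.\<close>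

section \<open>Signed measures on the torus\<close>

text \<open>That \<open>\<rho>\<close> is the only eigenvalue of maximal modulus does not by itself
  bound the normalised powers: a Jordan block for \<open>\<rho>\<close> would make them grow
  polynomially. The mass bound excludes this for vectors of \<open>V_hat\<close>, which is why the
  product is built from matrices compressed to that space and why convergence is proved orbit by
  orbit. Jordan forms are avoided: the roots of an annihilating polynomial are split off one at a
  time, each step being a scalar recurrence. Rows from the row space act as test functionals. Since
  \<open>V_hat\<close> lies inside the row space, they detect every coordinate, so bounds on values
  of \<open>g\<close> become bounds on vectors. Positivity is available for the generators only; a
  general entry is a real combination of their limits, hence a signed measure. As
  \<open>signed_integral\<close> is a definite description, it is controlled only once a
  decomposition is known; \<open>torus_signed\<close> records this and is carried through every
  construction. The weak limit passes through the last convolution because its left factor has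
  finite support: the convolution is a finite sum of translates.\<close>

definition torus_signed :: "(real set \<Rightarrow> real) \<Rightarrow> bool" where
  "torus_signed \<nu> \<longleftrightarrow>
     (\<exists>M N. finite_measure M \<and> finite_measure N \<and> sets M = sets torus \<and> sets N = sets torus \<and>
        (\<forall>A\<in>sets torus. \<nu> A = measure M A - measure N A))"

text \<open>The integrands to which \<open>signed_integral_eq\<close> applies. The class contains
  the periodic continuous functions as well as the combinations of indicators that arise inside
  \<open>torus_conv\<close>.\<close>

definition torus_bounded :: "(real \<Rightarrow> real) \<Rightarrow> bool" where
  "torus_bounded f \<longleftrightarrow> f \<in> borel_measurable torus \<and> (\<exists>C. \<forall>t\<in>{0..<1}. \<bar>f t\<bar> \<le> C)"

lemma space_torus [simp]: "space torus = {0..<1}"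
  by (simp add: torus_def space_restrict_space)

lemma sets_torusD: "A \<in> sets torus \<Longrightarrow> A \<subseteq> {0..<1}"
  using sets.sets_into_space[of A torus] by simp

lemma borel_measurable_frac [measurable]: "(frac :: real \<Rightarrow> real) \<in> borel_measurable borel"
  unfolding frac_def by simp

lemma measurable_frac_torus [measurable]: "frac \<in> borel \<rightarrow>\<^sub>M torus"
  unfolding torus_def by (rule measurable_restrict_space2) (auto simp: frac_lt_1)

lemma measurable_frac_shift [measurable]: "(\<lambda>y. frac (c + y)) \<in> torus \<rightarrow>\<^sub>M torus"
proof -
  have "(\<lambda>y. frac (c + y)) \<in> borel \<rightarrow>\<^sub>M torus"
    by (rule measurable_compose[OF _ measurable_frac_torus]) simp
  then show ?thesis
    unfolding torus_def by (rule measurable_restrict_space1)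
qed

lemma signed_integral_cong:
  assumes "\<And>A. A \<in> sets torus \<Longrightarrow> \<nu> A = \<nu>' A"
  shows "signed_integral \<nu> f = signed_integral \<nu>' f"
  unfolding signed_integral_def using assms by simp

lemma torus_signed_cong:
  assumes "\<And>A. A \<in> sets torus \<Longrightarrow> \<nu> A = \<nu>' A"
  shows "torus_signed \<nu> \<longleftrightarrow> torus_signed \<nu>'"
  unfolding torus_signed_def using assms by simp

lemma torus_signed_measure:
  assumes "finite_measure M" "sets M = sets torus"
  shows "torus_signed (measure M)"
    and "torus_bounded f \<Longrightarrow> signed_integral (measure M) f = (\<integral>t. f t \<partial>M)"
proof -
  have n: "finite_measure (null_measure torus)"
    by (rule finite_measureI) simp
  show "torus_signed (measure M)"
    unfolding torus_signed_def using assms n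
    by (intro exI[of _ M] exI[of _ "null_measure torus"]) simp
  show "signed_integral (measure M) f = (\<integral>t. f t \<partial>M)" if f: "torus_bounded f"
  proof -
    obtain C where "f \<in> borel_measurable torus" "\<And>t. t \<in> {0..<1} \<Longrightarrow> \<bar>f t\<bar> \<le> C"
      using f unfolding torus_bounded_def by blast
    then have "signed_integral (measure M) f = (\<integral>t. f t \<partial>M) - (\<integral>t. f t \<partial>null_measure torus)"
      using assms n by (intro signed_integral_eq) auto
    then show ?thesis by simp
  qed
qed

lemma torus_signedE:
  assumes "torus_signed \<nu>"
  obtains M N where "finite_measure M" "finite_measure N" "sets M = sets torus"
    "sets N = sets torus" "\<And>A. A \<in> sets torus \<Longrightarrow> \<nu> A = measure M A - measure N A"
    "\<And>f. torus_bounded f \<Longrightarrow> signed_integral \<nu> f = (\<integral>t. f t \<partial>M) - (\<integral>t. f t \<partial>N)"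
proof -
  obtain M N where *: "finite_measure M" "finite_measure N" "sets M = sets torus"
    "sets N = sets torus" "\<And>A. A \<in> sets torus \<Longrightarrow> \<nu> A = measure M A - measure N A"
    using assms unfolding torus_signed_def by blast
  moreover have "signed_integral \<nu> f = (\<integral>t. f t \<partial>M) - (\<integral>t. f t \<partial>N)" if "torus_bounded f" for f
    using that * unfolding torus_bounded_def by (auto intro!: signed_integral_eq)
  ultimately show ?thesis using that by blast
qed

lemma torus_signedI:
  assumes "finite_measure M" "finite_measure N" "sets M = sets torus"
    "sets N = sets torus" "\<And>A. A \<in> sets torus \<Longrightarrow> \<nu> A = measure M A - measure N A"
  shows "torus_signed \<nu>"
    and "torus_bounded f \<Longrightarrow> signed_integral \<nu> f = (\<integral>t. f t \<partial>M) - (\<integral>t. f t \<partial>N)"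
proof -
  show "torus_signed \<nu>" using assms unfolding torus_signed_def by blast
  show "torus_bounded f \<Longrightarrow> signed_integral \<nu> f = (\<integral>t. f t \<partial>M) - (\<integral>t. f t \<partial>N)"
    using assms unfolding torus_bounded_def by (auto intro!: signed_integral_eq)
qed

text \<open>Used to add two decompositions, positive parts and negative parts separately, and to
  move a negative part to the other side of an equation.\<close>

lemma sum_measure_exists:
  assumes M: "finite_measure M" "sets M = sets torus" and N: "finite_measure N" "sets N = sets torus"
  obtains S where "finite_measure S" "sets S = sets torus"
    "\<And>A. A \<in> sets torus \<Longrightarrow> measure S A = measure M A + measure N A"
    "\<And>f. torus_bounded f \<Longrightarrow> (\<integral>t. f t \<partial>S) = (\<integral>t. f t \<partial>M) + (\<integral>t. f t \<partial>N)"
proof -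
  interpret M: finite_measure M by fact
  interpret N: finite_measure N by fact
  define S where "S = measure_of {0..<1} (sets torus) (\<lambda>A. emeasure M A + emeasure N A)"
  have setsS: "sets S = sets torus"
    unfolding S_def using sets.space_closed[of torus] sets.sigma_sets_eq[of torus]
    by (simp add: sets_measure_of)
  have "countably_additive (sets torus) (\<lambda>A. emeasure M A + emeasure N A)"
  proof (rule countably_additiveI)
    fix A :: "nat \<Rightarrow> real set"
    assume A: "range A \<subseteq> sets torus" "disjoint_family A"
    show "(\<Sum>i. emeasure M (A i) + emeasure N (A i)) = emeasure M (\<Union>i. A i) + emeasure N (\<Union>i. A i)"
      using A M(2) N(2) by (simp add: suminf_add[symmetric] suminf_emeasure)
  qed
  then have em: "emeasure S A = emeasure M A + emeasure N A" if "A \<in> sets torus" for A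
    using that setsS
    by (intro emeasure_measure_of[OF S_def]) (auto simp: positive_def dest: sets_torusD)
  have spS: "space S = {0..<1}" using sets_eq_imp_space_eq[OF setsS] by simp
  have finS: "finite_measure S"
    using em[OF sets.top[of torus]] by (intro finite_measureI) (simp add: spS)
  have ms: "measure S A = measure M A + measure N A" if "A \<in> sets torus" for A
  proof -
    have "emeasure S A = ennreal (measure M A + measure N A)"
      using em[OF that] by (simp add: M.emeasure_eq_measure N.emeasure_eq_measure)
    then show ?thesis by (intro measure_eq_emeasure_eq_ennreal) simp_all
  qed
  (* Additivity of the integral: the signed measure M is represented both by M and by S - N. *)
  have "(\<integral>t. f t \<partial>S) = (\<integral>t. f t \<partial>M) + (\<integral>t. f t \<partial>N)" if "torus_bounded f" for f
  proof -
    have "signed_integral (measure M) f = (\<integral>t. f t \<partial>S) - (\<integral>t. f t \<partial>N)"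
      using that finS N setsS ms by (intro torus_signedI(2)) auto
    then show ?thesis using torus_signed_measure(2)[OF M that] by simp
  qed
  with that finS setsS ms show ?thesis by blast
qed

lemma torus_signed_add:
  assumes "torus_signed \<nu>1" "torus_signed \<nu>2"
  shows "torus_signed (\<lambda>A. \<nu>1 A + \<nu>2 A)"
    and "torus_bounded f \<Longrightarrow>
      signed_integral (\<lambda>A. \<nu>1 A + \<nu>2 A) f = signed_integral \<nu>1 f + signed_integral \<nu>2 f"
proof -
  obtain M1 N1 where 1: "finite_measure M1" "finite_measure N1" "sets M1 = sets torus"
    "sets N1 = sets torus" "\<And>A. A \<in> sets torus \<Longrightarrow> \<nu>1 A = measure M1 A - measure N1 A"
    "\<And>f. torus_bounded f \<Longrightarrow> signed_integral \<nu>1 f = (\<integral>t. f t \<partial>M1) - (\<integral>t. f t \<partial>N1)"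
    using torus_signedE[OF assms(1)] by blast
  obtain M2 N2 where 2: "finite_measure M2" "finite_measure N2" "sets M2 = sets torus"
    "sets N2 = sets torus" "\<And>A. A \<in> sets torus \<Longrightarrow> \<nu>2 A = measure M2 A - measure N2 A"
    "\<And>f. torus_bounded f \<Longrightarrow> signed_integral \<nu>2 f = (\<integral>t. f t \<partial>M2) - (\<integral>t. f t \<partial>N2)"
    using torus_signedE[OF assms(2)] by blast
  obtain S where S: "finite_measure S" "sets S = sets torus"
    "\<And>A. A \<in> sets torus \<Longrightarrow> measure S A = measure M1 A + measure M2 A"
    "\<And>f. torus_bounded f \<Longrightarrow> (\<integral>t. f t \<partial>S) = (\<integral>t. f t \<partial>M1) + (\<integral>t. f t \<partial>M2)"
    using sum_measure_exists[OF 1(1,3) 2(1,3)] by blast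
  obtain T where T: "finite_measure T" "sets T = sets torus"
    "\<And>A. A \<in> sets torus \<Longrightarrow> measure T A = measure N1 A + measure N2 A"
    "\<And>f. torus_bounded f \<Longrightarrow> (\<integral>t. f t \<partial>T) = (\<integral>t. f t \<partial>N1) + (\<integral>t. f t \<partial>N2)"
    using sum_measure_exists[OF 1(2,4) 2(2,4)] by blast
  have eq: "\<nu>1 A + \<nu>2 A = measure S A - measure T A" if "A \<in> sets torus" for A
    using 1(5)[OF that] 2(5)[OF that] S(3)[OF that] T(3)[OF that] by simp
  note * = torus_signedI[where \<nu> = "\<lambda>A. \<nu>1 A + \<nu>2 A", OF S(1) T(1) S(2) T(2) eq]
  show "torus_signed (\<lambda>A. \<nu>1 A + \<nu>2 A)" by (rule *(1))
  show "torus_bounded f \<Longrightarrow>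
      signed_integral (\<lambda>A. \<nu>1 A + \<nu>2 A) f = signed_integral \<nu>1 f + signed_integral \<nu>2 f"
    using *(2)[of f] 1(6)[of f] 2(6)[of f] S(4)[of f] T(4)[of f] by simp
qed

text \<open>Both parts of the decomposition are scaled by a constant density, which forces
  \<open>c \<ge> 0\<close>. Negative scalars are reduced to this case by exchanging the two
  parts.\<close>

lemma torus_signed_scale_nonneg:
  assumes "torus_signed \<nu>" "c \<ge> 0"
  shows "torus_signed (\<lambda>A. c * \<nu> A)"
    and "torus_bounded f \<Longrightarrow> signed_integral (\<lambda>A. c * \<nu> A) f = c * signed_integral \<nu> f"
proof -
  obtain M N where 1: "finite_measure M" "finite_measure N" "sets M = sets torus"
    "sets N = sets torus" "\<And>A. A \<in> sets torus \<Longrightarrow> \<nu> A = measure M A - measure N A"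
    "\<And>f. torus_bounded f \<Longrightarrow> signed_integral \<nu> f = (\<integral>t. f t \<partial>M) - (\<integral>t. f t \<partial>N)"
    using torus_signedE[OF assms(1)] by blast
  have fin: "finite_measure (density K (\<lambda>_. ennreal c))" if "finite_measure K" for K :: "real measure"
    using finite_measure.emeasure_finite[OF that]
    by (intro finite_measureI) (simp add: emeasure_density_const ennreal_mult_eq_top_iff)
  have mea: "measure (density K (\<lambda>_. ennreal c)) A = c * measure K A"
    if "A \<in> sets K" for K :: "real measure" and A
    using assms(2) that by (simp add: measure_def emeasure_density_const enn2real_mult)
  have int: "(\<integral>t. f t \<partial>density K (\<lambda>_. ennreal c)) = c * (\<integral>t. f t \<partial>K)"
    if "torus_bounded f" "sets K = sets torus" for f K
  proof -
    have "f \<in> borel_measurable K"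
      using that by (simp add: torus_bounded_def measurable_cong_sets[OF that(2) refl])
    then show ?thesis using assms(2) by (simp add: integral_density)
  qed
  have eq: "c * \<nu> A = measure (density M (\<lambda>_. ennreal c)) A - measure (density N (\<lambda>_. ennreal c)) A"
    if "A \<in> sets torus" for A
    using that 1(3,4) by (simp add: mea 1(5)[OF that] right_diff_distrib)
  note * = torus_signedI[where \<nu> = "\<lambda>A. c * \<nu> A", OF fin[OF 1(1)] fin[OF 1(2)] _ _ eq]
  show "torus_signed (\<lambda>A. c * \<nu> A)" using 1 by (intro *(1)) auto
  show "torus_bounded f \<Longrightarrow> signed_integral (\<lambda>A. c * \<nu> A) f = c * signed_integral \<nu> f"
    using *(2)[of f] 1(3,4) by (simp add: int 1(6) right_diff_distrib)
qed

lemma torus_signed_uminus: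
  assumes "torus_signed \<nu>"
  shows "torus_signed (\<lambda>A. - \<nu> A)"
    and "torus_bounded f \<Longrightarrow> signed_integral (\<lambda>A. - \<nu> A) f = - signed_integral \<nu> f"
proof -
  obtain M N where 1: "finite_measure M" "finite_measure N" "sets M = sets torus"
    "sets N = sets torus" "\<And>A. A \<in> sets torus \<Longrightarrow> \<nu> A = measure M A - measure N A"
    "\<And>f. torus_bounded f \<Longrightarrow> signed_integral \<nu> f = (\<integral>t. f t \<partial>M) - (\<integral>t. f t \<partial>N)"
    using torus_signedE[OF assms(1)] by blast
  have eq: "- \<nu> A = measure N A - measure M A" if "A \<in> sets torus" for A
    using 1(5)[OF that] by simp
  note * = torus_signedI[where \<nu> = "\<lambda>A. - \<nu> A", OF 1(2,1,4,3) eq]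
  show "torus_signed (\<lambda>A. - \<nu> A)" by (rule *(1))
  show "torus_bounded f \<Longrightarrow> signed_integral (\<lambda>A. - \<nu> A) f = - signed_integral \<nu> f"
    using *(2)[of f] 1(6)[of f] by simp
qed

lemma torus_signed_scale:
  assumes "torus_signed \<nu>"
  shows "torus_signed (\<lambda>A. c * \<nu> A)"
    and "torus_bounded f \<Longrightarrow> signed_integral (\<lambda>A. c * \<nu> A) f = c * signed_integral \<nu> f"
proof -
  have "torus_signed (\<lambda>A. c * \<nu> A) \<and>
    (torus_bounded f \<longrightarrow> signed_integral (\<lambda>A. c * \<nu> A) f = c * signed_integral \<nu> f)"
  proof (cases "c \<ge> 0")
    case True
    then show ?thesis using torus_signed_scale_nonneg[OF assms] by blast
  next
    case False
    then have c: "- c \<ge> 0" by simp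
    have "(\<lambda>A. c * \<nu> A) = (\<lambda>A. - c * - \<nu> A)" by simp
    then show ?thesis
      using torus_signed_scale_nonneg[OF torus_signed_uminus(1)[OF assms] c]
        torus_signed_uminus(2)[OF assms] by simp
  qed
  then show "torus_signed (\<lambda>A. c * \<nu> A)"
    and "torus_bounded f \<Longrightarrow> signed_integral (\<lambda>A. c * \<nu> A) f = c * signed_integral \<nu> f"
    by blast+
qed

lemma torus_signed_zero:
  shows "torus_signed (\<lambda>A. 0)" and "torus_bounded f \<Longrightarrow> signed_integral (\<lambda>A. 0) f = 0"
proof -
  have n: "finite_measure (null_measure torus)"
    by (rule finite_measureI) simp
  have "measure (null_measure torus) = (\<lambda>A. 0)"
    by (auto simp: fun_eq_iff measure_def)
  then show "torus_signed (\<lambda>A. 0)" "torus_bounded f \<Longrightarrow> signed_integral (\<lambda>A. 0) f = 0"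
    using torus_signed_measure[OF n] by (simp_all add: integral_null_measure)
qed

lemma torus_signed_sum:
  assumes "\<And>i. i \<in> I \<Longrightarrow> torus_signed (\<nu> i)"
  shows "torus_signed (\<lambda>A. \<Sum>i\<in>I. \<nu> i A)"
    and "torus_bounded f \<Longrightarrow>
      signed_integral (\<lambda>A. \<Sum>i\<in>I. \<nu> i A) f = (\<Sum>i\<in>I. signed_integral (\<nu> i) f)"
proof -
  have "torus_signed (\<lambda>A. \<Sum>i\<in>I. \<nu> i A) \<and> (torus_bounded f \<longrightarrow>
      signed_integral (\<lambda>A. \<Sum>i\<in>I. \<nu> i A) f = (\<Sum>i\<in>I. signed_integral (\<nu> i) f))"
    using assms
  proof (induction I rule: infinite_finite_induct)
    case (insert i I)
    then show ?case using torus_signed_add[of "\<nu> i" "\<lambda>A. \<Sum>i\<in>I. \<nu> i A"] by simp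
  qed (use torus_signed_zero in auto)
  then show "torus_signed (\<lambda>A. \<Sum>i\<in>I. \<nu> i A)"
    "torus_bounded f \<Longrightarrow>
      signed_integral (\<lambda>A. \<Sum>i\<in>I. \<nu> i A) f = (\<Sum>i\<in>I. signed_integral (\<nu> i) f)" by blast+
qed

lemma torus_signed_dirac:
  shows "torus_signed (torus_dirac c)"
    and "torus_bounded f \<Longrightarrow> signed_integral (torus_dirac c) f = f (frac c)"
proof -
  have fr: "frac c \<in> space torus" by (simp add: frac_lt_1)
  have 1: "finite_measure (return torus (frac c))"
    using prob_space_return[OF fr] by (simp add: prob_space.finite_measure)
  have 2: "torus_dirac c A = measure (return torus (frac c)) A" if "A \<in> sets torus" for A
    using that by (simp add: torus_dirac_def measure_return)
  have 3: "torus_signed (torus_dirac c) \<longleftrightarrow> torus_signed (measure (return torus (frac c)))"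
    by (intro torus_signed_cong 2)
  have 4: "signed_integral (torus_dirac c) f = signed_integral (measure (return torus (frac c))) f"
    by (intro signed_integral_cong 2)
  note * = torus_signed_measure[OF 1]
  show "torus_signed (torus_dirac c)" unfolding 3 by (rule *(1)) simp
  show "signed_integral (torus_dirac c) f = f (frac c)" if "torus_bounded f"
    unfolding 4 using *(2)[of f] that fr by (simp add: integral_return torus_bounded_def)
qed

lemma torus_signed_imp_vector_measure:
  assumes "torus_signed \<nu>"
  shows "torus_vector_measure \<nu>"
  unfolding torus_vector_measure_def
proof (intro allI impI, elim conjE)
  fix A :: "nat \<Rightarrow> real set" assume A: "range A \<subseteq> sets torus" "disjoint_family A"
  obtain M N where 1: "finite_measure M" "finite_measure N" "sets M = sets torus"
    "sets N = sets torus" "\<And>A. A \<in> sets torus \<Longrightarrow> \<nu> A = measure M A - measure N A"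
    "\<And>f. torus_bounded f \<Longrightarrow> signed_integral \<nu> f = (\<integral>t. f t \<partial>M) - (\<integral>t. f t \<partial>N)"
    using torus_signedE[OF assms(1)] by blast
  have "(\<lambda>i. measure M (A i) - measure N (A i)) sums
      (measure M (\<Union>i. A i) - measure N (\<Union>i. A i))"
    using A 1 by (intro sums_diff finite_measure.finite_measure_UNION) auto
  moreover have "(\<Union>i. A i) \<in> sets torus" using A(1) by blast
  moreover have "\<nu> (A i) = measure M (A i) - measure N (A i)" for i
    using A(1) by (intro 1(5)) auto
  ultimately show "(\<lambda>i. \<nu> (A i)) sums \<nu> (\<Union>i. A i)"
    using 1(5) by simp
qed

text \<open>The preimage of \<open>A\<close> under the rotation by \<open>c\<close>. Thus
  \<open>\<nu> (torus_shift c A)\<close>, as a function of \<open>A\<close>, is the translate of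
  \<open>\<nu>\<close> by \<open>c\<close>, that is, its convolution with the Dirac measure at
  \<open>c\<close>.\<close>

definition torus_shift :: "real \<Rightarrow> real set \<Rightarrow> real set" where
  "torus_shift c A = {y \<in> {0..<1}. frac (c + y) \<in> A}"

lemma torus_shift_sets: "A \<in> sets torus \<Longrightarrow> torus_shift c A \<in> sets torus"
proof -
  assume "A \<in> sets torus"
  then have "(\<lambda>y. frac (c + y)) -` A \<inter> space torus \<in> sets torus"
    by (rule measurable_sets[OF measurable_frac_shift])
  also have "(\<lambda>y. frac (c + y)) -` A \<inter> space torus = torus_shift c A"
    by (auto simp: torus_shift_def)
  finally show ?thesis .
qed

lemma torus_bounded_shift:
  assumes "torus_bounded f" shows "torus_bounded (\<lambda>y. f (frac (c + y)))"
  unfolding torus_bounded_def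
proof
  show "(\<lambda>y. f (frac (c + y))) \<in> borel_measurable torus"
    using assms unfolding torus_bounded_def
    by (intro measurable_compose[OF measurable_frac_shift]) simp
  obtain C where "\<forall>t\<in>{0..<1}. \<bar>f t\<bar> \<le> C" using assms unfolding torus_bounded_def by blast
  then show "\<exists>C. \<forall>t\<in>{0..<1}. \<bar>f (frac (c + t))\<bar> \<le> C"
    by (intro exI[of _ C]) (simp add: frac_lt_1)
qed

lemma torus_signed_shift:
  assumes "torus_signed \<nu>"
  shows "torus_signed (\<lambda>A. \<nu> (torus_shift c A))"
    and "torus_bounded f \<Longrightarrow>
      signed_integral (\<lambda>A. \<nu> (torus_shift c A)) f = signed_integral \<nu> (\<lambda>y. f (frac (c + y)))"
proof -
  obtain M N where 1: "finite_measure M" "finite_measure N" "sets M = sets torus"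
    "sets N = sets torus" "\<And>A. A \<in> sets torus \<Longrightarrow> \<nu> A = measure M A - measure N A"
    "\<And>f. torus_bounded f \<Longrightarrow> signed_integral \<nu> f = (\<integral>t. f t \<partial>M) - (\<integral>t. f t \<partial>N)"
    using torus_signedE[OF assms(1)] by blast
  let ?d = "\<lambda>K. distr K torus (\<lambda>y. frac (c + y))"
  have meas: "(\<lambda>y. frac (c + y)) \<in> K \<rightarrow>\<^sub>M torus" if "sets K = sets torus" for K
    by (subst measurable_cong_sets[OF that refl]) simp
  have fin: "finite_measure (?d K)" if "finite_measure K" "sets K = sets torus" for K
    using finite_measure.finite_measure_distr[OF that(1) meas[OF that(2)]] .
  have mea: "measure (?d K) A = measure K (torus_shift c A)"
    if "sets K = sets torus" "A \<in> sets torus" for K A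
  proof -
    have "space K = {0..<1}" using sets_eq_imp_space_eq[OF that(1)] by simp
    then have "(\<lambda>y. frac (c + y)) -` A \<inter> space K = torus_shift c A"
      unfolding torus_shift_def by blast
    then show ?thesis using measure_distr[OF meas[OF that(1)] that(2)] by simp
  qed
  have eq: "\<nu> (torus_shift c A) = measure (?d M) A - measure (?d N) A" if "A \<in> sets torus" for A
    using 1(5)[OF torus_shift_sets[OF that]] mea[OF 1(3) that] mea[OF 1(4) that] by simp
  note * = torus_signedI[where \<nu> = "\<lambda>A. \<nu> (torus_shift c A)", OF fin[OF 1(1,3)] fin[OF 1(2,4)] _ _ eq]
  show "torus_signed (\<lambda>A. \<nu> (torus_shift c A))" by (intro *(1)) auto
  show "signed_integral (\<lambda>A. \<nu> (torus_shift c A)) f = signed_integral \<nu> (\<lambda>y. f (frac (c + y)))"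
    if f: "torus_bounded f"
  proof -
    have "(\<integral>t. f t \<partial>?d K) = (\<integral>t. f (frac (c + t)) \<partial>K)" if "sets K = sets torus" for K
      using f meas[OF that] by (intro integral_distr) (auto simp: torus_bounded_def)
    then show ?thesis using *(2)[OF _ _ _ f] 1(6)[OF torus_bounded_shift[OF f]] 1(3,4) by simp
  qed
qed

text \<open>\<open>torus_conv\<close> integrates a function built from its left argument against the
  right one. For a finitely supported left argument this function is a finite combination of
  indicators, so no Fubini argument arises; all left factors in the theorem are of this
  kind.\<close>

lemma torus_conv_dirac_sum:
  assumes \<mu>: "\<And>A. A \<in> sets torus \<Longrightarrow> \<mu> A = (\<Sum>l\<in>I. c l * torus_dirac (p l) A)"
    and \<nu>: "torus_signed \<nu>" and A: "A \<in> sets torus"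
  shows "torus_conv \<mu> \<nu> A = (\<Sum>l\<in>I. c l * \<nu> (torus_shift (p l) A))"
proof -
  have eq: "frac (frac (p l) + y) = frac (p l + y)" for l y
    by (simp add: frac_unique_iff frac_lt_1)
  have ind: "(\<lambda>y. \<mu> {x \<in> {0..<1}. frac (x + y) \<in> A}) = (\<lambda>y. \<Sum>l\<in>I. c l * indicator A (frac (p l + y)))"
  proof
    fix y
    have "{x \<in> {0..<1}. frac (x + y) \<in> A} = torus_shift y A"
      by (auto simp: torus_shift_def add.commute)
    then have e: "\<mu> {x \<in> {0..<1}. frac (x + y) \<in> A} = (\<Sum>l\<in>I. c l * torus_dirac (p l) (torus_shift y A))"
      using \<mu>[OF torus_shift_sets[OF A]] by simp
    have d: "torus_dirac (p l) (torus_shift y A) = indicator A (frac (p l + y))" for l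
      using eq[of l y]
      by (auto simp: torus_dirac_def torus_shift_def indicator_def frac_lt_1 add.commute)
    show "\<mu> {x \<in> {0..<1}. frac (x + y) \<in> A} = (\<Sum>l\<in>I. c l * indicator A (frac (p l + y)))"
      unfolding e d ..
  qed
  obtain M N where 1: "finite_measure M" "finite_measure N" "sets M = sets torus"
    "sets N = sets torus" "\<And>A. A \<in> sets torus \<Longrightarrow> \<nu> A = measure M A - measure N A"
    "\<And>f. torus_bounded f \<Longrightarrow> signed_integral \<nu> f = (\<integral>t. f t \<partial>M) - (\<integral>t. f t \<partial>N)"
    using torus_signedE[OF \<nu>] by blast
  have indA: "torus_bounded (indicator A)"
    using A unfolding torus_bounded_def by (auto intro!: exI[of _ 1])
  have int: "(\<integral>y. (\<Sum>l\<in>I. c l * indicator A (frac (p l + y))) \<partial>K) = (\<Sum>l\<in>I. c l * measure K (torus_shift (p l) A))"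
    if K: "finite_measure K" "sets K = sets torus" for K
  proof -
    interpret finite_measure K by fact
    have sp: "space K = {0..<1}" using sets_eq_imp_space_eq[OF K(2)] by simp
    have e: "(\<integral>y. indicator A (frac (p l + y)) \<partial>K) = measure K (torus_shift (p l) A)" for l
    proof -
      have "(\<integral>y. indicator A (frac (p l + y)) \<partial>K) = (\<integral>y. (indicator (torus_shift (p l) A) y :: real) \<partial>K)"
        by (intro Bochner_Integration.integral_cong) (auto simp: sp torus_shift_def indicator_def)
      then show ?thesis using torus_shift_sets[OF A] K(2) by simp
    qed
    have "integrable K (\<lambda>y. c l * indicator A (frac (p l + y)))" for l
    proof -
      have "(\<lambda>y. indicator A (frac (p l + y)) :: real) \<in> borel_measurable K"
        using torus_bounded_shift[OF indA] measurable_cong_sets[OF K(2) refl]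
        unfolding torus_bounded_def by blast
      then have "integrable K (\<lambda>y. indicator A (frac (p l + y)) :: real)"
        by (intro integrable_const_bound[of _ 1]) (auto simp: indicator_def)
      then show ?thesis by simp
    qed
    then show ?thesis by (simp add: Bochner_Integration.integral_sum e)
  qed
  have bd: "torus_bounded (\<lambda>y. \<Sum>l\<in>I. c l * indicator A (frac (p l + y)))"
    unfolding torus_bounded_def
  proof (intro conjI exI ballI)
    show "(\<lambda>y. \<Sum>l\<in>I. c l * indicator A (frac (p l + y))) \<in> borel_measurable torus"
      using torus_bounded_shift[OF indA] unfolding torus_bounded_def
      by (intro borel_measurable_sum borel_measurable_times) auto
    show "\<bar>\<Sum>l\<in>I. c l * indicator A (frac (p l + y))\<bar> \<le> (\<Sum>l\<in>I. \<bar>c l\<bar>)" for y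
      by (intro order_trans[OF sum_abs] sum_mono) (auto simp: indicator_def)
  qed
  show ?thesis
    unfolding torus_conv_def ind 1(6)[OF bd] int[OF 1(1,3)] int[OF 1(2,4)]
    using 1(5)[OF torus_shift_sets[OF A]]
    by (simp add: sum_subtractf[symmetric] right_diff_distrib)
qed


section \<open>Weak limits on the torus\<close>

lemma torus_continuous_add_int:
  assumes "torus_continuous f" shows "f (t + of_int z) = f t"
proof (induction z rule: int_induct[where k = 0])
  case (step1 i)
  have "f (t + of_int (i + 1)) = f ((t + of_int i) + 1)" by (simp add: add.assoc)
  then show ?case using step1 assms unfolding torus_continuous_def by simp
next
  case (step2 i)
  have "f ((t + of_int (i - 1)) + 1) = f (t + of_int (i - 1))"
    using assms unfolding torus_continuous_def by blast
  moreover have "(t + of_int (i - 1)) + 1 = t + of_int i" by simp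
  ultimately show ?case using step2(2) by metis
qed simp

lemma torus_continuous_frac:
  assumes "torus_continuous f" shows "f (frac t) = f t"
  using torus_continuous_add_int[OF assms, of t "- \<lfloor>t\<rfloor>"] by (simp add: frac_def)

lemma torus_continuous_bound:
  assumes "torus_continuous f" shows "\<exists>C. \<forall>t. \<bar>f t\<bar> \<le> C"
proof -
  have "continuous_on {0..1} f"
    using assms continuous_on_subset unfolding torus_continuous_def by blast
  then have "bounded (f ` {0..1})"
    by (intro compact_imp_bounded compact_continuous_image) auto
  then obtain C where "\<forall>y\<in>f ` {0..1}. norm y \<le> C"
    unfolding bounded_iff by blast
  then have C: "\<bar>f t\<bar> \<le> C" if "t \<in> {0..1}" for t using that by simp
  have "\<bar>f t\<bar> \<le> C" for t
    using C[of "frac t"] torus_continuous_frac[OF assms, of t] frac_lt_1[of t] by simp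
  then show ?thesis by blast
qed

lemma torus_continuous_bounded:
  assumes "torus_continuous f" shows "torus_bounded f"
proof -
  have "f \<in> borel_measurable borel"
    using assms unfolding torus_continuous_def by (intro borel_measurable_continuous_onI) simp
  then have "f \<in> borel_measurable torus"
    unfolding torus_def by (rule measurable_restrict_space1)
  then show ?thesis
    using torus_continuous_bound[OF assms] unfolding torus_bounded_def by auto
qed

lemma torus_continuous_const: "torus_continuous (\<lambda>_. c)"
  by (simp add: torus_continuous_def)

lemma torus_continuous_shift: 
  assumes "torus_continuous f" shows "torus_continuous (\<lambda>t. f (c + t))"
proof -
  have "f ((c + t) + 1) = f (c + t)" for t
    using assms unfolding torus_continuous_def by blast
  moreover have "continuous_on UNIV (\<lambda>t. f (c + t))"
  proof (rule continuous_on_compose2[of UNIV f])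
    show "continuous_on UNIV f" using assms unfolding torus_continuous_def by blast
    show "continuous_on UNIV (\<lambda>t. c + t)" by (intro continuous_intros)
  qed simp
  ultimately show ?thesis by (simp add: torus_continuous_def add.assoc)
qed

lemma torus_continuous_uniform:
  assumes "torus_continuous f" "\<epsilon> > 0"
  obtains \<delta> where "\<delta> > 0"
    "\<And>s t. s \<in> {0..1} \<Longrightarrow> t \<in> {0..1} \<Longrightarrow> \<bar>s - t\<bar> < \<delta> \<Longrightarrow> \<bar>f s - f t\<bar> < \<epsilon>"
proof -
  have "uniformly_continuous_on {0..1} f"
    using assms continuous_on_subset unfolding torus_continuous_def
    by (intro compact_uniformly_continuous) auto
  then obtain \<delta> where "\<delta> > 0"
    "\<And>s t. s \<in> {0..1} \<Longrightarrow> t \<in> {0..1} \<Longrightarrow> dist s t < \<delta> \<Longrightarrow> dist (f s) (f t) < \<epsilon>"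
    using assms(2) unfolding uniformly_continuous_on_def by metis
  then show ?thesis using that by (simp add: dist_real_def)
qed

text \<open>For \<open>0 \<le> a < 1\<close> the arc \<open>(a, 1)\<close> is open on the circle
  too, because it stays away from the point 0; its indicator is therefore a pointwise limit of
  periodic continuous functions. Together with the whole circle and the empty set these arcs form an
  intersection-stable generator.\<close>

lemma torus_measure_eqI:
  assumes M: "finite_measure M" "sets M = sets torus" and N: "finite_measure N" "sets N = sets torus"
    and eq: "\<And>f. torus_continuous f \<Longrightarrow> (\<integral>t. f t \<partial>M) = (\<integral>t. f t \<partial>N)"
  shows "M = N"
proof -
  define E where "E = range (\<lambda>a::real. {0..<1} \<inter> {a<..})"
  have sets: "sets torus = sigma_sets {0..<1} E"
  proof -
    have "sets (borel :: real measure) = sigma_sets UNIV (range greaterThan)"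
      by (subst borel_Ioi) (simp add: sets_measure_of)
    moreover have "{0..<1::real} \<in> sigma_sets UNIV (range greaterThan)"
      unfolding calculation[symmetric] by simp
    ultimately have "sets torus = sigma_sets {0..<1} ((\<inter>) {0..<1} ` range greaterThan)"
      unfolding torus_def sets_restrict_space by (simp add: sigma_sets_Int)
    then show ?thesis by (simp add: E_def image_image)
  qed
  have spM: "space K = {0..<1}" if "sets K = sets torus" for K
    using sets_eq_imp_space_eq[OF that] by simp
  have full: "{0..<1} \<inter> {-1::real<..} = {0..<1}" by auto
  have tot: "measure M {0..<1} = measure N {0..<1}"
    using eq[OF torus_continuous_const[of 1]] spM[OF M(2)] spM[OF N(2)] by simp
  have em: "emeasure M ({0..<1} \<inter> {a<..}) = emeasure N ({0..<1} \<inter> {a<..})" for a :: real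
  proof -
    consider "a < 0" | "a \<ge> 1" | "0 \<le> a" "a < 1" by linarith
    then have "measure M ({0..<1} \<inter> {a<..}) = measure N ({0..<1} \<inter> {a<..})"
    proof cases
      case 1
      then have "{0..<1} \<inter> {a<..} = {0..<1}" by auto
      then show ?thesis using tot by simp
    next
      case 2
      then have "{0..<1} \<inter> {a<..} = {}" by auto
      then show ?thesis by simp
    next
      case 3
      define C where "C = {t::real. frac t \<le> a}"
      (* The distance to a periodic set is a periodic continuous function. *)
      define h where "h n t = min 1 (real n * infdist t C)" for n :: nat and t
      have Cne: "C \<noteq> {}" using 3 by (auto simp: C_def intro!: exI[of _ 0])
      have Cim: "C = (\<lambda>c. c + 1) ` C"
      proof (rule set_eqI)
        fix c :: real
        have "c = (c - 1) + 1" "frac (c - 1) = frac c"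
          by (simp_all add: frac_def)
        moreover have "frac (c' + 1) = frac c'" for c' :: real by (simp add: frac_def)
        ultimately show "c \<in> C \<longleftrightarrow> c \<in> (\<lambda>c. c + 1) ` C"
          unfolding C_def by (metis (no_types, lifting) image_iff mem_Collect_eq)
      qed
      have per: "infdist (t + 1) C = infdist t C" for t
      proof -
        have "infdist (t + 1) C = infdist (t + 1) ((\<lambda>c. c + 1) ` C)" using Cim by simp
        also have "\<dots> = infdist t C"
          using Cne by (simp add: infdist_def image_image)
        finally show ?thesis .
      qed
      have hc: "torus_continuous (h n)" for n
        unfolding torus_continuous_def h_def using per
        by (auto intro!: continuous_intros continuous_on_infdist)
      have lim: "(\<lambda>n. h n t) \<longlonglongrightarrow> indicator ({0..<1} \<inter> {a<..}) t" if t: "t \<in> {0..<1}" for t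
      proof (cases "t \<le> a")
        case True
        then have "t \<in> C" using t by (auto simp: C_def frac_eq)
        then have "h n t = 0" for n by (simp add: h_def)
        then show ?thesis using True by simp
      next
        case False
        \<comment> \<open>The points of \<open>C\<close> nearest to \<open>t\<close> are
          \<open>a\<close> on the left and 1 on the right.\<close>
        define d where "d = min (t - a) (1 - t)"
        have d: "d > 0" using False t by (simp add: d_def)
        have "d \<le> infdist t C"
          unfolding infdist_notempty[OF Cne]
        proof (rule cINF_greatest[OF Cne])
          fix c assume c: "c \<in> C"
          show "d \<le> dist t c"
          proof (cases "\<lfloor>c\<rfloor> \<ge> 1")
            case True
            then have "c \<ge> 1" by linarith
            then show ?thesis using t by (auto simp: d_def dist_real_def)
          next
            case False
            then have "\<lfloor>c\<rfloor> \<le> 0" by simp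
            then have "real_of_int \<lfloor>c\<rfloor> \<le> 0" by simp
            moreover have "c - real_of_int \<lfloor>c\<rfloor> \<le> a" using c unfolding C_def frac_def by blast
            ultimately have "c \<le> a" by linarith
            then show ?thesis by (auto simp: d_def dist_real_def)
          qed
        qed
        then have pos: "infdist t C > 0" using d by linarith
        have "\<forall>\<^sub>F n in sequentially. h n t = 1"
        proof -
          obtain n0 where n0: "1 < real n0 * infdist t C"
            using reals_Archimedean3[OF pos] by blast
          have "h n t = 1" if "n \<ge> n0" for n
          proof -
            have "real n0 * infdist t C \<le> real n * infdist t C"
              using that pos by (intro mult_right_mono) auto
            then show ?thesis using n0 by (simp add: h_def)
          qed
          then show ?thesis unfolding eventually_sequentially by blast
        qed
        then have "(\<lambda>n. h n t) \<longlonglongrightarrow> 1" by (rule tendsto_eventually)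
        moreover have "indicator ({0..<1} \<inter> {a<..}) t = (1::real)" using False t by simp
        ultimately show ?thesis by simp
      qed
      have int: "(\<lambda>n. \<integral>t. h n t \<partial>K) \<longlonglongrightarrow> measure K ({0..<1} \<inter> {a<..})"
        if K: "finite_measure K" "sets K = sets torus" for K
      proof -
        interpret finite_measure K by fact
        have inK: "{0..<1} \<inter> {a<..} \<in> sets K"
          unfolding K(2) sets E_def by (intro sigma_sets.Basic) blast
        have "(\<lambda>n. \<integral>t. h n t \<partial>K) \<longlonglongrightarrow> (\<integral>t. indicator ({0..<1} \<inter> {a<..}) t \<partial>K)"
        proof (rule integral_dominated_convergence[where w = "\<lambda>_. 1"])
          show "h n \<in> borel_measurable K" for n
            using torus_continuous_bounded[OF hc[of n]]
            by (simp add: torus_bounded_def measurable_cong_sets[OF K(2) refl])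
          show "AE t in K. (\<lambda>n. h n t) \<longlonglongrightarrow> indicator ({0..<1} \<inter> {a<..}) t"
            using lim spM[OF K(2)] by (intro AE_I2) simp
          show "AE t in K. norm (h n t) \<le> 1" for n
            by (intro AE_I2) (simp add: h_def infdist_nonneg)
        qed (use inK in auto)
        then show ?thesis using inK by simp
      qed
      show ?thesis
        using int[OF M] int[OF N] eq[OF hc] by (simp add: LIMSEQ_unique)
    qed
    then show ?thesis
      using M(1) N(1) by (simp add: finite_measure.emeasure_eq_measure)
  qed
  show "M = N"
  proof (rule measure_eqI_generator_eq[where \<Omega> = "{0..<1}" and E = E and A = "\<lambda>_. {0..<1}"])
    show "Int_stable E"
    proof (rule Int_stableI)
      fix X Y assume "X \<in> E" "Y \<in> E"
      then obtain a b :: real where "X = {0..<1} \<inter> {a<..}" "Y = {0..<1} \<inter> {b<..}"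
        unfolding E_def by blast
      then have "X \<inter> Y = {0..<1} \<inter> {max a b<..}" by auto
      then show "X \<inter> Y \<in> E" unfolding E_def by blast
    qed
    show "E \<subseteq> Pow {0..<1}" unfolding E_def by blast
    show "emeasure M X = emeasure N X" if "X \<in> E" for X
      using that em unfolding E_def by blast
    show "sets M = sigma_sets {0..<1} E" "sets N = sigma_sets {0..<1} E"
      using M(2) N(2) sets by simp_all
    have "{0..<1} \<in> E" unfolding E_def using full by blast
    then show "range (\<lambda>_. {0..<1}) \<subseteq> E" by blast
    show "emeasure M {0..<1} \<noteq> \<infinity>" using finite_measure.emeasure_finite[OF M(1)] by simp
  qed simp
qed

text \<open>With \<open>\<nu>\<close> decomposed as \<open>M - N\<close>, the claim becomes
  \<open>\<mu> + N = M\<close>, an equality of positive measures, to which uniqueness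
  applies.\<close>

lemma torus_signed_eqI:
  assumes \<nu>: "torus_signed \<nu>" and \<mu>: "finite_measure \<mu>" "sets \<mu> = sets torus"
    and eq: "\<And>f. torus_continuous f \<Longrightarrow> signed_integral \<nu> f = (\<integral>t. f t \<partial>\<mu>)"
    and A: "A \<in> sets torus"
  shows "measure \<mu> A = \<nu> A"
proof -
  obtain M N where 1: "finite_measure M" "finite_measure N" "sets M = sets torus"
    "sets N = sets torus" "\<And>A. A \<in> sets torus \<Longrightarrow> \<nu> A = measure M A - measure N A"
    "\<And>f. torus_bounded f \<Longrightarrow> signed_integral \<nu> f = (\<integral>t. f t \<partial>M) - (\<integral>t. f t \<partial>N)"
    using torus_signedE[OF \<nu>] by blast
  obtain S where S: "finite_measure S" "sets S = sets torus"
    "\<And>A. A \<in> sets torus \<Longrightarrow> measure S A = measure \<mu> A + measure N A"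
    "\<And>f. torus_bounded f \<Longrightarrow> (\<integral>t. f t \<partial>S) = (\<integral>t. f t \<partial>\<mu>) + (\<integral>t. f t \<partial>N)"
    using sum_measure_exists[OF \<mu> 1(2,4)] by blast
  have "S = M"
  proof (rule torus_measure_eqI[OF S(1,2) 1(1,3)])
    fix f assume f: "torus_continuous f"
    note b = torus_continuous_bounded[OF f]
    show "(\<integral>t. f t \<partial>S) = (\<integral>t. f t \<partial>M)"
      using eq[OF f] 1(6)[OF b] S(4)[OF b] by simp
  qed
  then show ?thesis using S(3)[OF A] 1(5)[OF A] by simp
qed

lemma torus_signed_lincomb:
  assumes "torus_signed \<nu>1" "torus_signed \<nu>2"
  shows "torus_signed (\<lambda>A. c * \<nu>1 A + \<nu>2 A)"
    and "torus_continuous f \<Longrightarrow>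
      signed_integral (\<lambda>A. c * \<nu>1 A + \<nu>2 A) f = c * signed_integral \<nu>1 f + signed_integral \<nu>2 f"
  using torus_signed_add[OF torus_signed_scale(1)[OF assms(1), of c] assms(2)]
    torus_signed_scale(2)[OF assms(1), of f c] torus_continuous_bounded[of f] by simp_all

text \<open>The integrals are already known to converge; what is missing is a measure representing
  their limits. Compactness provides one along a subsequence, and this suffices because the full
  sequence of integrals has the same limit.\<close>

lemma discrete_torus_measures_limit:
  fixes p pt :: "nat \<Rightarrow> nat \<Rightarrow> real" and n :: "nat \<Rightarrow> nat"
  assumes p: "\<And>N l. l < n N \<Longrightarrow> p N l \<ge> 0" and K: "\<And>N. (\<Sum>l<n N. p N l) \<le> K"
    and pt: "\<And>N l. l < n N \<Longrightarrow> pt N l \<in> {0..<1}"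
    and conv: "\<And>f. torus_continuous f \<Longrightarrow> convergent (\<lambda>N. \<Sum>l<n N. f (pt N l) * p N l)"
  obtains \<nu> where "torus_signed \<nu>"
    "\<And>f. torus_continuous f \<Longrightarrow> (\<lambda>N. \<Sum>l<n N. f (pt N l) * p N l) \<longlonglongrightarrow> signed_integral \<nu> f"
proof -
  \<comment> \<open>Any strictly positive bound for the masses would do; it becomes the common total
    mass before normalisation.\<close>
  define K' where "K' = \<bar>K\<bar> + 1"
  have K': "K' > 0" "(\<Sum>l<n N. p N l) \<le> K'" for N using K[of N] by (auto simp: K'_def)
  define m where "m N = (\<Sum>l<n N. p N l)" for N
  (* The missing mass is put at 0, so that Helly's theorem for probability measures on the line applies. *)
  define q where "q N l = (if l < n N then p N l / K' else 1 - m N / K')" for N l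
  define s where "s N l = (if l < n N then pt N l else 0)" for N l
  define P where "P N = distr (point_measure {..n N} (\<lambda>l. ennreal (q N l))) borel (s N)" for N
  have q0: "q N l \<ge> 0" for N l using p K' by (simp add: q_def m_def)
  have s01: "s N l \<in> {0..<1}" for N l using pt by (simp add: s_def)
  have sq: "(\<Sum>l\<le>n N. g (s N l) * q N l) = ((\<Sum>l<n N. g (pt N l) * p N l) + g 0 * (K' - m N)) / K'"
    for g :: "real \<Rightarrow> real" and N
  proof -
    have "{..n N} = insert (n N) {..<n N}" by auto
    then have "(\<Sum>l\<le>n N. g (s N l) * q N l) = g 0 * (1 - m N / K') + (\<Sum>l<n N. g (pt N l) * (p N l / K'))"
      by (simp add: q_def s_def)
    also have "(\<Sum>l<n N. g (pt N l) * (p N l / K')) = (\<Sum>l<n N. g (pt N l) * p N l) / K'"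
      by (simp add: sum_divide_distrib)
    also have "g 0 * (1 - m N / K') = g 0 * (K' - m N) / K'"
      using K'(1) by (simp add: right_diff_distrib diff_divide_distrib)
    finally show ?thesis by (simp add: add_divide_distrib)
  qed
  have meas: "s N \<in> point_measure {..n N} (\<lambda>l. ennreal (q N l)) \<rightarrow>\<^sub>M borel" for N
    by (simp add: point_measure_def)
  have intP: "(\<integral>t. g t \<partial>P N) = ((\<Sum>l<n N. g (pt N l) * p N l) + g 0 * (K' - m N)) / K'"
    if "g \<in> borel_measurable borel" for g :: "real \<Rightarrow> real" and N
  proof -
    have "(\<integral>t. g t \<partial>P N) = (\<Sum>l\<le>n N. q N l * g (s N l))"
      unfolding P_def using that meas q0
      by (subst integral_distr) (simp_all add: lebesgue_integral_point_measure_finite)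
    also have "\<dots> = (\<Sum>l\<le>n N. g (s N l) * q N l)" by (simp add: mult.commute)
    finally show ?thesis using sq by simp
  qed
  have sum1: "(\<Sum>l\<le>n N. q N l) = 1" for N
    using sq[of "\<lambda>_. 1" N] K'(1) by (simp add: m_def)
  have ps: "prob_space (point_measure {..n N} (\<lambda>l. ennreal (q N l)))" for N
    using sum1[of N] q0
    by (intro prob_spaceI) (simp add: emeasure_point_measure_finite space_point_measure)
  interpret P: real_distribution "P N" for N
    unfolding P_def using prob_space.prob_space_distr[OF ps meas] 
    by (simp add: real_distribution_def real_distribution_axioms_def)
  \<comment> \<open>The left endpoint lies strictly below 0: the intervals of \<open>tight\<close>
    are open on the left, and the missing mass sits at 0.\<close>
  have "measure (P N) {-1<..1} = 1" for N
  proof -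
    have s01': "s N l \<in> {-1<..1}" for l using s01[of N l] by simp
    have "s N -` {-1<..1} \<inter> space (point_measure {..n N} (\<lambda>l. ennreal (q N l))) =
        space (point_measure {..n N} (\<lambda>l. ennreal (q N l)))"
      using s01' by auto
    then show ?thesis unfolding P_def
      by (subst measure_distr[OF meas]) (simp_all add: prob_space.prob_space[OF ps])
  qed
  then have "tight P"
    unfolding tight_def using P.real_distribution_axioms
    by (intro conjI allI impI exI[of _ "-1"] exI[of _ 1]) simp_all
  from tight_imp_convergent_subsubsequence[OF this, of id]
  obtain r M where r: "strict_mono r" and M: "real_distribution M" "weak_conv_m (P \<circ> id \<circ> r) M"
    by (auto simp: strict_mono_id)
  interpret M: real_distribution M by fact
  \<comment> \<open>The limit on the line may charge the point 1. Folding by \<open>frac\<close>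
    moves this mass to 0, which no periodic integrand notices.\<close>
  define T where "T = distr M torus frac"
  have fracM: "frac \<in> M \<rightarrow>\<^sub>M torus"
    using M.events_eq_borel by (subst measurable_cong_sets[OF M.events_eq_borel refl]) simp
  have T: "finite_measure T" "sets T = sets torus"
    unfolding T_def using M.finite_measure_distr[OF fracM] by simp_all
  obtain m' where m': "m \<longlonglongrightarrow> m'"
    using conv[OF torus_continuous_const[of 1]] unfolding m_def[abs_def] convergent_def by auto
  \<comment> \<open>Undoes the normalisation by \<open>K'\<close> and removes the auxiliary mass at
    0, which tends to \<open>K' - m'\<close>.\<close>
  define \<nu> where "\<nu> = (\<lambda>A. K' * measure T A + (m' - K') * torus_dirac 0 A)"
  have s: "torus_signed (\<lambda>A. K' * measure T A)" "torus_signed (\<lambda>A. (m' - K') * torus_dirac 0 A)"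
    by (intro torus_signed_scale(1) torus_signed_measure(1) torus_signed_dirac(1) T)+
  have tsn: "torus_signed \<nu>" unfolding \<nu>_def by (rule torus_signed_add(1)[OF s])
  have "(\<lambda>N. \<Sum>l<n N. f (pt N l) * p N l) \<longlonglongrightarrow> signed_integral \<nu> f" if f: "torus_continuous f" for f
  proof -
    obtain C where C: "\<And>t. \<bar>f t\<bar> \<le> C" using torus_continuous_bound[OF f] by blast
    note b = torus_continuous_bounded[OF f]
    have fb: "f \<in> borel_measurable borel"
      using f unfolding torus_continuous_def by (intro borel_measurable_continuous_onI) simp
    obtain L where L: "(\<lambda>N. \<Sum>l<n N. f (pt N l) * p N l) \<longlonglongrightarrow> L"
      using conv[OF f] unfolding convergent_def by blast
    have "(\<lambda>N. ((\<Sum>l<n N. f (pt N l) * p N l) + f 0 * (K' - m N)) / K') \<longlonglongrightarrow> (L + f 0 * (K' - m')) / K'"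
      by (intro tendsto_intros L m') (use K' in auto)
    then have "(\<lambda>N. \<integral>t. f t \<partial>P N) \<longlonglongrightarrow> (L + f 0 * (K' - m')) / K'"
      by (simp add: intP[OF fb])
    then have "((\<lambda>N. \<integral>t. f t \<partial>P N) \<circ> r) \<longlonglongrightarrow> (L + f 0 * (K' - m')) / K'"
      using r by (rule LIMSEQ_subseq_LIMSEQ)
    moreover have "(\<lambda>N. \<integral>t. f t \<partial>(P \<circ> id \<circ> r) N) \<longlonglongrightarrow> (\<integral>t. f t \<partial>M)"
    proof (rule weak_conv_imp_integral_bdd_continuous_conv[of _ M])
      show "isCont f x" for x
        using f continuous_on_eq_continuous_at[OF open_UNIV] unfolding torus_continuous_def by blast
      show "norm (f x) \<le> C" for x using C by simp
    qed (use M P.real_distribution_axioms in \<open>auto simp: o_def\<close>)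
    ultimately have "(\<integral>t. f t \<partial>M) = (L + f 0 * (K' - m')) / K'"
      by (simp add: o_def LIMSEQ_unique)
    moreover have "(\<integral>t. f t \<partial>T) = (\<integral>t. f t \<partial>M)"
      unfolding T_def using b fracM 
      by (subst integral_distr) (simp_all add: torus_bounded_def torus_continuous_frac[OF f])
    ultimately have IT: "(\<integral>t. f t \<partial>T) = (L + f 0 * (K' - m')) / K'" by simp
    have "signed_integral \<nu> f = K' * (\<integral>t. f t \<partial>T) + (m' - K') * f 0"
      unfolding \<nu>_def
      by (simp add: torus_signed_add(2)[OF s b]
          torus_signed_scale(2)[OF torus_signed_measure(1)[OF T] b]
          torus_signed_scale(2)[OF torus_signed_dirac(1) b]
          torus_signed_measure(2)[OF T b] torus_signed_dirac(2)[OF b])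
    also have "\<dots> = L" using K' by (simp add: IT field_simps)
    finally show ?thesis using L by simp
  qed
  with tsn that show ?thesis by blast
qed


section \<open>Convergence of normalized matrix powers\<close>

text \<open>\<open>poly_mv p A v\<close> is \<open>p(A) v\<close>, evaluated by Horner's scheme.\<close>

definition poly_mv :: "complex poly \<Rightarrow> complex^'d^'d \<Rightarrow> complex^'d \<Rightarrow> complex^'d" where
  "poly_mv p A v = fold_coeffs (\<lambda>a u. a *s v + A *v u) p 0"

lemma poly_mv_0 [simp]: "poly_mv 0 A v = 0"
  by (simp add: poly_mv_def)

lemma poly_mv_pCons [simp]: "poly_mv (pCons a p) A v = a *s v + A *v poly_mv p A v"
  by (cases "p = 0"; cases "a = 0") (simp_all add: poly_mv_def)

lemma poly_mv_add: "poly_mv (p + q) A v = poly_mv p A v + poly_mv q A v"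
  by (induction p q rule: poly_induct2)
    (simp_all add: vec.scale_left_distrib matrix_vector_right_distrib)

lemma poly_mv_diff: "poly_mv (p - q) A v = poly_mv p A v - poly_mv q A v"
  by (induction p q rule: poly_induct2)
    (simp_all add: vec.scale_left_diff_distrib matrix_vector_mult_diff_distrib)

lemma poly_mv_smult: "poly_mv (smult c p) A v = c *s poly_mv p A v"
  by (induction p)
    (simp_all add: vec.scale_right_distrib vector_scalar_commute)

lemma poly_mv_diff_right: "poly_mv p A (v - u) = poly_mv p A v - poly_mv p A u"
  by (induction p)
    (simp_all add: vec.scale_right_diff_distrib matrix_vector_mult_diff_distrib)

lemma poly_mv_scale_right: "poly_mv p A (c *s v) = c *s poly_mv p A v"
  by (induction p)
    (simp_all add: vec.scale_right_distrib vector_scalar_commute mult.commute)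

lemma poly_mv_commute: "poly_mv p A (A *v v) = A *v poly_mv p A v"
  by (induction p)
    (simp_all add: matrix_vector_right_distrib vector_scalar_commute)

lemma poly_mv_linear_factor:
  "poly_mv ([:- l, 1:] * q) A v = A *v poly_mv q A v - l *s poly_mv q A v"
  by (simp add: mult_pCons_left poly_mv_diff poly_mv_smult)

lemma poly_mv_monom: "poly_mv (monom c i) A v = c *s (((*v) A) ^^ i) v"
  by (induction i) (simp_all add: monom_0 monom_Suc vector_scalar_commute)

lemma poly_mv_sum: "poly_mv (\<Sum>i\<in>I. p i) A v = (\<Sum>i\<in>I. poly_mv (p i) A v)"
  by (induction I rule: infinite_finite_induct) (simp_all add: poly_mv_add)

lemma poly_mv_eigenvector:
  assumes "A *v v = l *s v" shows "poly_mv p A v = poly p l *s v"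
  by (induction p)
    (simp_all add: vector_scalar_commute assms vec.scale_left_distrib mult.commute)

text \<open>Repetitions among the \<open>m i\<close> are treated separately:
  \<open>dependent\<close> speaks of the set of values, which is then too small, but a repeated
  value gives the combination \<open>m i - m j\<close>.\<close>

lemma nontrivial_combination:
  fixes m :: "nat \<Rightarrow> 'a::euclidean_space"
  obtains c where "\<exists>i\<le>DIM('a). c i \<noteq> (0::real)" "(\<Sum>i\<le>DIM('a). c i *\<^sub>R m i) = 0"
proof (cases "inj_on m {..DIM('a)}")
  case True
  have "dependent (m ` {..DIM('a)})"
    using True by (intro dependent_biggerset) (auto simp: card_image)
  then obtain u where u: "\<exists>v\<in>m ` {..DIM('a)}. u v \<noteq> 0" "(\<Sum>v\<in>m ` {..DIM('a)}. u v *\<^sub>R v) = 0"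
    using dependent_finite[of "m ` {..DIM('a)}"] by auto
  show ?thesis
    using u True by (intro that[of "\<lambda>i. u (m i)"]) (auto simp: sum.reindex)
next
  case False
  then obtain i j where ij: "i \<le> DIM('a)" "j \<le> DIM('a)" "i \<noteq> j" "m i = m j"
    unfolding inj_on_def by auto
  define c :: "nat \<Rightarrow> real" where "c l = (if l = i then 1 else 0) - (if l = j then 1 else 0)" for l
  have "(\<Sum>l\<le>DIM('a). c l *\<^sub>R m l) =
      (\<Sum>l\<le>DIM('a). if l = i then m l else 0) - (\<Sum>l\<le>DIM('a). if l = j then m l else 0)"
    unfolding sum_subtractf[symmetric] by (intro sum.cong) (auto simp: c_def)
  also have "\<dots> = 0" using ij by (simp add: sum.delta')
  finally show ?thesis using ij by (intro that[of c]) (auto simp: c_def)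
qed

lemma map_matrix_of_real_mult:
  "map_matrix complex_of_real (A ** B) = map_matrix complex_of_real A ** map_matrix complex_of_real B"
  by (simp add: map_matrix_def matrix_matrix_mult_def vec_eq_iff)

text \<open>The powers of \<open>A\<close> with exponents up to the dimension of the matrix space
  are one too many to be independent. The relation has real coefficients and is then read over the
  complex numbers.\<close>

lemma annihilating_polynomial:
  fixes A :: "real^'d^'d"
  shows "\<exists>p. p \<noteq> 0 \<and> (\<forall>v. poly_mv p (map_matrix complex_of_real A) v = 0)"
proof -
  define M where "M i = ((**) A ^^ i) (mat 1)" for i
  let ?D = "DIM(real^'d^'d)" and ?A = "map_matrix complex_of_real A"
  have pow: "(((*v) ?A) ^^ i) v = map_matrix complex_of_real (M i) *v v" for i v
  proof (induction i)
    case 0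
    have "map_matrix complex_of_real (mat 1 :: real^'d^'d) = mat 1"
      by (simp add: map_matrix_def mat_def vec_eq_iff)
    then show ?case by (simp add: M_def)
  next
    case (Suc i)
    then show ?case by (simp add: M_def map_matrix_of_real_mult matrix_vector_mul_assoc)
  qed
  obtain c where c: "\<exists>i\<le>?D. c i \<noteq> 0" "(\<Sum>i\<le>?D. c i *\<^sub>R M i) = 0"
    using nontrivial_combination[of M] by blast
  define p where "p = (\<Sum>i\<le>?D. monom (complex_of_real (c i)) i)"
  have "coeff p i = (if i \<le> ?D then complex_of_real (c i) else 0)" for i
    unfolding p_def coeff_sum by (simp add: sum.delta)
  with c(1) have "p \<noteq> 0" by (metis coeff_0 of_real_eq_0_iff)
  moreover have "poly_mv p ?A v = 0" for v
  proof -
    have "poly_mv p ?A v $ a = 0" for a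
    proof -
      have z: "(\<Sum>i\<le>?D. c i * M i $ a $ j) = 0" for j
        using arg_cong[OF c(2), of "\<lambda>X. X $ a $ j"] by simp
      have "poly_mv p ?A v = (\<Sum>i\<le>?D. complex_of_real (c i) *s (map_matrix complex_of_real (M i) *v v))"
        by (simp only: p_def poly_mv_sum poly_mv_monom pow)
      then have "poly_mv p ?A v $ a =
          (\<Sum>i\<le>?D. \<Sum>j\<in>UNIV. complex_of_real (c i * M i $ a $ j) * v $ j)"
        by (simp add: matrix_vector_mult_def sum_distrib_left mult.assoc)
      also have "\<dots> = (\<Sum>j\<in>UNIV. \<Sum>i\<le>?D. complex_of_real (c i * M i $ a $ j) * v $ j)"
        by (rule sum.swap)
      also have "\<dots> = (\<Sum>j\<in>UNIV. complex_of_real (\<Sum>i\<le>?D. c i * M i $ a $ j) * v $ j)"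
        by (simp add: sum_distrib_right)
      also have "\<dots> = 0" unfolding z by simp
      finally show ?thesis .
    qed
    then show ?thesis by (simp add: vec_eq_iff)
  qed
  ultimately show ?thesis by blast
qed

text \<open>Take an annihilating polynomial of least degree. If a root \<open>z\<close> is split
  off, the cofactor \<open>q\<close> no longer annihilates everything, and any nonzero
  \<open>q(A) v\<close> is an eigenvector for \<open>z\<close>. Conversely
  \<open>p(A) v = p(z) v\<close> for an eigenvector \<open>v\<close>.\<close>

lemma minimal_polynomial:
  fixes A :: "real^'d^'d"
  obtains p where "p \<noteq> 0" "\<And>v. poly_mv p (map_matrix complex_of_real A) v = 0"
    "eigenvalues A = {z. poly p z = 0}"
proof -
  let ?A = "map_matrix complex_of_real A"
  let ?P = "\<lambda>p. p \<noteq> 0 \<and> (\<forall>v. poly_mv p ?A v = 0)"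
  obtain p0 where "?P p0" using annihilating_polynomial[of A] by blast
  then obtain p where p: "?P p" "\<And>q. ?P q \<Longrightarrow> degree p \<le> degree q"
    using ex_has_least_nat[of ?P p0 degree] by blast
  have "z \<in> eigenvalues A" if z: "poly p z = 0" for z
  proof -
    obtain q where q: "p = [:- z, 1:] * q" using z by (auto simp: poly_eq_0_iff_dvd)
    have q0: "q \<noteq> 0" using p(1) q by auto
    then have "degree p = Suc (degree q)"
      unfolding q by (subst degree_mult_eq) auto
    then have "\<not> ?P q" using p(2)[of q] by auto
    then obtain v where v: "poly_mv q ?A v \<noteq> 0" using q0 by blast
    have "?A *v poly_mv q ?A v = z *s poly_mv q ?A v"
      using p(1) poly_mv_linear_factor[of z q ?A v] unfolding q by simp
    then show ?thesis using v unfolding eigenvalues_def by blast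
  qed
  moreover have "poly p z = 0" if z: "z \<in> eigenvalues A" for z
  proof -
    obtain v where v: "v \<noteq> 0" "?A *v v = z *s v" using z unfolding eigenvalues_def by blast
    then have "poly p z *s v = 0" using poly_mv_eigenvector[OF v(2), of p] p(1) by simp
    then show ?thesis using v(1) by simp
  qed
  ultimately have "eigenvalues A = {z. poly p z = 0}" by blast
  with p(1) that show ?thesis by blast
qed

text \<open>Makes the \<open>Max\<close> in \<open>spectral_radius\<close> a genuine
  maximum.\<close>

lemma finite_eigenvalues: "finite (eigenvalues A)"
  using minimal_polynomial[of A] poly_roots_finite by metis

lemma cmod_eigenvalue_le: "z \<in> eigenvalues A \<Longrightarrow> cmod z \<le> spectral_radius A"
  unfolding spectral_radius_def by (intro Max_ge) (auto simp: finite_eigenvalues)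

section \<open>Linear recurrences with a geometrically convergent perturbation\<close>

text \<open>Mere convergence is not preserved by the recurrence below when the root is 1; a geometric rate is,
  since it makes the increments summable.\<close>

definition geometrically_convergent :: "(nat \<Rightarrow> complex) \<Rightarrow> bool" where
  "geometrically_convergent b \<longleftrightarrow> (\<exists>c K r. 0 \<le> r \<and> r < 1 \<and> (\<forall>n. cmod (b n - c) \<le> K * r ^ n))"

lemma geometrically_convergent_imp_convergent:
  assumes "geometrically_convergent b" shows "convergent b"
proof -
  obtain c K r where r: "0 \<le> r" "r < 1" "\<And>n. cmod (b n - c) \<le> K * r ^ n"
    using assms unfolding geometrically_convergent_def by blast
  have "(\<lambda>n. K * r ^ n) \<longlonglongrightarrow> K * 0"
    using r by (intro tendsto_intros LIMSEQ_power_zero) auto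
  then have "(\<lambda>n. b n - c) \<longlonglongrightarrow> 0"
    using r(3) by (intro Lim_null_comparison[of "\<lambda>n. b n - c" "\<lambda>n. K * r ^ n"]) auto
  then have "b \<longlonglongrightarrow> c" by (simp add: LIM_zero_iff)
  then show ?thesis unfolding convergent_def by blast
qed

lemma geometrically_convergent_divide:
  assumes "geometrically_convergent b" shows "geometrically_convergent (\<lambda>n. b n / d)"
proof -
  obtain c K r where r: "0 \<le> r" "r < 1" "\<And>n. cmod (b n - c) \<le> K * r ^ n"
    using assms unfolding geometrically_convergent_def by blast
  have "cmod (b n / d - c / d) \<le> (K / cmod d) * r ^ n" for n
    using divide_right_mono[OF r(3), of "cmod d" n]
    by (simp add: diff_divide_distrib[symmetric] norm_divide)
  then show ?thesis using r(1,2) unfolding geometrically_convergent_def by blast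
qed

text \<open>For \<open>cmod l < 1\<close> the recurrence is a contraction towards a fixed point. For
  \<open>l = 1\<close> the increments tend to \<open>c\<close>, and boundedness of \<open>b\<close>
  forces \<open>c = 0\<close>, so that the increments form a geometrically dominated series. The
  second case is where polynomial growth from a Jordan block is ruled out.\<close>

lemma geometrically_convergent_recurrence:
  assumes b': "geometrically_convergent b'" and rec: "\<And>n. b (Suc n) = l * b n + b' n"
    and l: "cmod l < 1 \<or> l = 1" and bdd: "\<And>n. cmod (b n) \<le> C"
  shows "geometrically_convergent b"
proof -
  obtain c K r where r: "0 \<le> r" "r < 1" "\<And>n. cmod (b' n - c) \<le> K * r ^ n"
    using b' unfolding geometrically_convergent_def by blast
  have K: "K \<ge> 0" using order_trans[OF norm_ge_zero r(3)[of 0]] by simp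
  show ?thesis
  proof (cases "cmod l < 1")
    case True
    \<comment> \<open>A rate strictly worse than both \<open>r\<close> and \<open>cmod l\<close>
      absorbs the resonance \<open>n * r ^ n\<close> that occurs when the two coincide.\<close>
    obtain s where s: "max r (cmod l) < s" "s < 1" using dense[of "max r (cmod l)" 1] True r by auto
    \<comment> \<open>\<open>c / (1 - l)\<close> is the fixed point of the recurrence with
      \<open>b'\<close> replaced by its limit.\<close>
    define e where "e n = b n - c / (1 - l)" for n
    have l1: "1 - l \<noteq> 0" using True by auto
    have e: "e (Suc n) = l * e n + (b' n - c)" for n
      using l1 by (simp add: e_def rec field_simps)
    \<comment> \<open>The first argument starts the induction; the second is the smallest constant
      with \<open>cmod l * K2 + K \<le> K2 * s\<close>, which is what the induction step
      requires.\<close>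
    define K2 where "K2 = max (cmod (e 0)) (K / (s - cmod l))"
    have sl: "s - cmod l > 0" using s by simp
    have K2: "cmod l * K2 + K \<le> K2 * s"
    proof -
      have "K / (s - cmod l) \<le> K2" by (simp add: K2_def)
      then have "K \<le> K2 * (s - cmod l)" using sl by (simp add: pos_divide_le_eq)
      then show ?thesis by (simp add: algebra_simps)
    qed
    have "cmod (e n) \<le> K2 * s ^ n" for n
    proof (induction n)
      case 0
      then show ?case by (simp add: K2_def)
    next
      case (Suc n)
      have "cmod (e (Suc n)) \<le> cmod l * cmod (e n) + cmod (b' n - c)"
        unfolding e by (metis norm_mult norm_triangle_ineq)
      also have "\<dots> \<le> cmod l * (K2 * s ^ n) + K * s ^ n"
      proof (intro add_mono mult_left_mono Suc.IH)
        have "K * r ^ n \<le> K * s ^ n" using r s K by (intro mult_left_mono power_mono) auto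
        then show "cmod (b' n - c) \<le> K * s ^ n" using r(3)[of n] by linarith
      qed simp
      also have "\<dots> = (cmod l * K2 + K) * s ^ n" by (simp add: algebra_simps)
      also have "\<dots> \<le> (K2 * s) * s ^ n"
        using K2 s r by (intro mult_right_mono) auto
      finally show ?case by (simp add: algebra_simps)
    qed
    then have "cmod (b n - c / (1 - l)) \<le> K2 * s ^ n" for n by (simp add: e_def)
    then show ?thesis
      using s r(1) unfolding geometrically_convergent_def
      by (intro exI[of _ "c / (1 - l)"] exI[of _ K2] exI[of _ s]) auto
  next
    case False
    then have l1: "l = 1" using l by blast
    define d where "d n = b' n - c" for n
    have dK: "cmod (d n) \<le> K * r ^ n" for n using r(3) by (simp add: d_def)
    have geo: "(\<lambda>n. K * r ^ n) sums (K * (1 / (1 - r)))"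
      using r by (intro sums_mult geometric_sums) auto
    have sd: "summable (\<lambda>n. cmod (d n))"
      using dK by (intro summable_comparison_test'[OF sums_summable[OF geo], of 0]) auto
    then have sd': "summable d" by (rule summable_norm_cancel)
    have bn: "b n = b 0 + of_nat n * c + (\<Sum>i<n. d i)" for n
      by (induction n) (simp_all add: rec l1 d_def algebra_simps)
    \<comment> \<open>By \<open>bn\<close>, a nonzero \<open>c\<close> would make \<open>b\<close>
      grow linearly, contradicting the bound \<open>C\<close>.\<close>
    have c0: "c = 0"
    proof (rule ccontr)
      assume "c \<noteq> 0"
      then have "cmod c > 0" by simp
      then obtain n where n: "2 * C + (\<Sum>i. cmod (d i)) < real n * cmod c"
        using reals_Archimedean3 by blast
      have "of_nat n * c = b n - b 0 - (\<Sum>i<n. d i)" using bn[of n] by simp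
      then have "cmod (of_nat n * c) \<le> cmod (b n) + cmod (b 0) + cmod (\<Sum>i<n. d i)"
        using norm_triangle_ineq4[of "b n - b 0" "\<Sum>i<n. d i"] norm_triangle_ineq4[of "b n" "b 0"]
        by simp
      also have "cmod (\<Sum>i<n. d i) \<le> (\<Sum>i<n. cmod (d i))" by (rule norm_sum)
      also have "\<dots> \<le> (\<Sum>i. cmod (d i))" using sd by (intro sum_le_suminf) auto
      finally show False using n bdd[of n] bdd[of 0] by (simp add: norm_mult)
    qed
    define L where "L = b 0 + suminf d"
    have "cmod (b n - L) \<le> (K / (1 - r)) * r ^ n" for n
    proof -
      have "b n - L = - (\<Sum>i. d (i + n))"
        using bn[of n] c0 suminf_split_initial_segment[OF sd', of n] by (simp add: L_def)
      then have "cmod (b n - L) = cmod (\<Sum>i. d (i + n))" by simp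
      also have "\<dots> \<le> (\<Sum>i. cmod (d (i + n)))"
        by (intro summable_norm summable_ignore_initial_segment sd)
      also have "\<dots> \<le> (\<Sum>i. (K * r ^ n) * r ^ i)"
      proof (rule suminf_le)
        show "cmod (d (i + n)) \<le> K * r ^ n * r ^ i" for i
          using dK[of "i + n"] by (simp add: power_add ac_simps)
        show "summable (\<lambda>i. cmod (d (i + n)))" by (intro summable_ignore_initial_segment sd)
        show "summable (\<lambda>i. K * r ^ n * r ^ i)" using r by (intro summable_mult summable_geometric) auto
      qed
      also have "\<dots> = (K / (1 - r)) * r ^ n"
        using r by (simp add: suminf_mult summable_geometric suminf_geometric)
      finally show ?thesis .
    qed
    then show ?thesis using r(1,2) unfolding geometrically_convergent_def by blast
  qed
qed

text \<open>Induction on the degree of a polynomial annihilating the single vector \<open>v\<close>.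
  For a root \<open>z\<close>, the vector \<open>u = A v - z v\<close> is annihilated by the
  cofactor and inherits the boundedness; the normalised orbit of \<open>v\<close> then satisfies a
  scalar recurrence with factor \<open>z / \<rho>\<close> and the orbit of \<open>u\<close> as
  perturbation.\<close>

lemma orbit_geometrically_convergent:
  fixes A :: "complex^'d^'d"
  assumes "p \<noteq> 0" "poly_mv p A v = 0" "\<rho> > 0"
    and "\<And>z. poly p z = 0 \<Longrightarrow> cmod z < \<rho> \<or> z = complex_of_real \<rho>"
    and "\<And>i. \<exists>C. \<forall>n. cmod ((((*v) A) ^^ n) v $ i / complex_of_real \<rho> ^ n) \<le> C"
  shows "geometrically_convergent (\<lambda>n. (((*v) A) ^^ n) v $ i / complex_of_real \<rho> ^ n)"
  using assms
proof (induction "degree p" arbitrary: p v i)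
  case 0
  then obtain a where a: "p = [:a:]" by (metis degree_eq_zeroE)
  then have "v = 0" using 0 by auto
  moreover have "(((*v) A) ^^ n) 0 = 0" for n by (induction n) simp_all
  ultimately show ?case
    by (auto simp: geometrically_convergent_def intro!: exI[of _ 0])
next
  case (Suc m)
  have "\<not> constant (poly p)" using Suc.hyps(2) by (simp add: constant_degree)
  then obtain z where z: "poly p z = 0" using fundamental_theorem_of_algebra by blast
  then obtain q where q: "p = [:- z, 1:] * q" by (auto simp: poly_eq_0_iff_dvd)
  have q0: "q \<noteq> 0" using Suc.prems(1) q by auto
  then have dq: "m = degree q"
    using Suc.hyps(2) unfolding q by (subst (asm) degree_mult_eq) auto
  define u where "u = A *v v - z *s v"
  have qu: "poly_mv q A u = 0"
    using Suc.prems(2) unfolding u_def q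
    by (simp add: poly_mv_diff_right poly_mv_commute poly_mv_scale_right poly_mv_linear_factor
        del: mult_pCons_left)
  have \<rho>0: "complex_of_real \<rho> \<noteq> 0" using Suc.prems(3) by simp
  let ?b = "\<lambda>v i n. (((*v) A) ^^ n) v $ i / complex_of_real \<rho> ^ n"
  have un: "(((*v) A) ^^ n) u = (((*v) A) ^^ Suc n) v - z *s (((*v) A) ^^ n) v" for n
  proof (induction n)
    case (Suc n)
    then show ?case
      by (simp add: matrix_vector_mult_diff_distrib vector_scalar_commute)
  qed (simp add: u_def)
  have bu: "?b u i n = \<rho> * ?b v i (Suc n) - z * ?b v i n" for i n
    using \<rho>0 by (simp only: un) (simp add: field_simps)
  have bdd: "\<exists>C. \<forall>n. cmod (?b u i n) \<le> C" for i
  proof -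
    obtain C where C: "\<And>n. cmod (?b v i n) \<le> C" using Suc.prems(5) by blast
    have "cmod (?b u i n) \<le> \<rho> * C + cmod z * C" for n
    proof -
      have "cmod (?b u i n) \<le> cmod (\<rho> * ?b v i (Suc n)) + cmod (z * ?b v i n)"
        unfolding bu by (rule norm_triangle_ineq4)
      also have "\<dots> = \<rho> * cmod (?b v i (Suc n)) + cmod z * cmod (?b v i n)"
        using Suc.prems(3) by (simp only: norm_mult) simp
      also have "\<dots> \<le> \<rho> * C + cmod z * C"
        using Suc.prems(3) by (intro add_mono mult_left_mono C) auto
      finally show ?thesis .
    qed
    then show ?thesis by blast
  qed
  have "geometrically_convergent (?b u i)"
  proof (rule Suc.hyps(1)[OF dq q0 qu Suc.prems(3) _ bdd])
    show "cmod y < \<rho> \<or> y = complex_of_real \<rho>" if "poly q y = 0" for y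
      using Suc.prems(4)[of y] that q by simp
  qed
  then have g: "geometrically_convergent (\<lambda>n. ?b u i n / \<rho>)"
    by (rule geometrically_convergent_divide)
  obtain C where C: "\<And>n. cmod (?b v i n) \<le> C" using Suc.prems(5) by blast
  have z1: "cmod (z / \<rho>) < 1 \<or> z / \<rho> = 1"
    using Suc.prems(4)[OF z] Suc.prems(3) by (auto simp: norm_divide)
  have "?b v i (Suc n) = (z / \<rho>) * ?b v i n + ?b u i n / \<rho>" for n
    unfolding bu using \<rho>0 by (simp add: field_simps)
  then show ?case by (rule geometrically_convergent_recurrence[OF g _ z1 C])
qed

text \<open>Transfer to real matrices by complexification. The boundedness assumption concerns the
  orbit of \<open>v\<close> alone, so \<open>A\<close> may still have a Jordan block for
  \<open>\<rho>\<close> elsewhere.\<close>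

lemma convergent_normalized_powers:
  fixes A :: "real^'d^'d"
  defines "\<rho> \<equiv> spectral_radius A"
  assumes \<rho>: "\<rho> > 0" and peri: "\<And>z. z \<in> eigenvalues A \<Longrightarrow> cmod z = \<rho> \<Longrightarrow> z = complex_of_real \<rho>"
    and bdd: "\<And>i. \<exists>C. \<forall>n. \<bar>(((*v) A) ^^ n) v $ i / \<rho> ^ n\<bar> \<le> C"
  shows "convergent (\<lambda>n. (((*v) A) ^^ n) v $ i / \<rho> ^ n)"
proof -
  let ?A = "map_matrix complex_of_real A"
  define cv where "cv u = (\<chi> i. complex_of_real (u $ i))" for u :: "real^'d"
  have "?A *v cv u = cv (A *v u)" for u
    by (simp add: cv_def map_matrix_def matrix_vector_mult_def vec_eq_iff)
  then have pow: "(((*v) ?A) ^^ n) (cv v) = cv ((((*v) A) ^^ n) v)" for n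
    by (induction n) simp_all
  have comp: "(((*v) ?A) ^^ n) (cv v) $ i / complex_of_real \<rho> ^ n =
      complex_of_real ((((*v) A) ^^ n) v $ i / \<rho> ^ n)" for n i
    unfolding pow by (simp add: cv_def)
  obtain p where p: "p \<noteq> 0" "\<And>v. poly_mv p ?A v = 0" "eigenvalues A = {z. poly p z = 0}"
    using minimal_polynomial[of A] by blast
  have "geometrically_convergent (\<lambda>n. (((*v) ?A) ^^ n) (cv v) $ i / complex_of_real \<rho> ^ n)"
  proof (rule orbit_geometrically_convergent[OF p(1,2) \<rho>])
    fix z assume "poly p z = 0"
    then have z: "z \<in> eigenvalues A" using p(3) by blast
    show "cmod z < \<rho> \<or> z = complex_of_real \<rho>"
      using cmod_eigenvalue_le[OF z] peri[OF z] unfolding \<rho>_def by linarith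
  next
    fix i show "\<exists>C. \<forall>n. cmod ((((*v) ?A) ^^ n) (cv v) $ i / complex_of_real \<rho> ^ n) \<le> C"
      using bdd[of i] unfolding comp norm_of_real by simp
  qed
  then have "convergent (\<lambda>n. complex_of_real ((((*v) A) ^^ n) v $ i / \<rho> ^ n))"
    unfolding comp by (rule geometrically_convergent_imp_convergent)
  then obtain c where "(\<lambda>n. complex_of_real ((((*v) A) ^^ n) v $ i / \<rho> ^ n)) \<longlonglongrightarrow> c"
    unfolding convergent_def by blast
  then have "(\<lambda>n. (((*v) A) ^^ n) v $ i / \<rho> ^ n) \<longlonglongrightarrow> Re c"
    using tendsto_Re by fastforce
  then show ?thesis unfolding convergent_def by blast
qed


section \<open>Sums and products of matrices\<close>

text \<open>With \<open>b\<close> a power of \<open>k\<close>, this cuts a digit word into a prefix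
  \<open>i\<close> and a suffix \<open>j\<close>.\<close>

lemma sum_lessThan_times:
  fixes f :: "nat \<Rightarrow> 'a::comm_monoid_add"
  shows "(\<Sum>l<a * b. f l) = (\<Sum>i<a. \<Sum>j<b. f (i * b + j))"
proof -
  have "(\<Sum>l\<in>{i * b..<i * b + b}. f l) = (\<Sum>j<b. f (i * b + j))" for i
    using sum.shift_bounds_nat_ivl[of f 0 "i * b" b]
    by (simp add: atLeast0LessThan add.commute)
  then show ?thesis using sum.nat_group[of f b a] by simp
qed

lemma mult_add_less:
  fixes i j :: nat
  assumes "i < a" "j < b" shows "i * b + j < a * b"
proof -
  have "i * b + j < Suc i * b" using assms(2) by simp
  also have "\<dots> \<le> a * b" using assms(1) by (intro mult_right_mono) auto
  finally show ?thesis .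
qed

lemma matrix_vector_mult_sum_left:
  "(\<Sum>i\<in>I. A i) *v y = (\<Sum>i\<in>I. A i *v y)" for A :: "'i \<Rightarrow> real^'d^'e"
  by (induction I rule: infinite_finite_induct) (simp_all add: matrix_vector_mult_add_rdistrib)

lemma matrix_vector_mult_sum_right:
  "A *v (\<Sum>i\<in>I. y i) = (\<Sum>i\<in>I. A *v y i)" for A :: "real^'d^'e"
  by (induction I rule: infinite_finite_induct) (simp_all add: matrix_vector_right_distrib)

lemma matrix_mult_sum_left:
  "(\<Sum>i\<in>I. A i) ** D = (\<Sum>i\<in>I. A i ** D)" for A :: "'i \<Rightarrow> real^'d^'e"
  by (simp add: matrix_eq matrix_vector_mult_sum_left matrix_vector_mul_assoc[symmetric])

lemma matrix_mult_sum_right: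
  "D ** (\<Sum>i\<in>I. A i) = (\<Sum>i\<in>I. D ** A i)" for A :: "'i \<Rightarrow> real^'d^'e"
  by (simp add: matrix_eq matrix_vector_mult_sum_left matrix_vector_mult_sum_right
      matrix_vector_mul_assoc[symmetric])


section \<open>Padded digit words\<close>

text \<open>The product of the matrices of the \<open>N\<close> digits of \<open>l\<close>, leading zeros included, as opposed to
  \<^const>\<open>mat_digits\<close>. Digits beyond the \<open>N\<close>-th are ignored.\<close>

primrec padded_word :: "nat \<Rightarrow> (nat \<Rightarrow> real^'d^'d) \<Rightarrow> nat \<Rightarrow> nat \<Rightarrow> real^'d^'d" where
  "padded_word k C 0 l = mat 1"
| "padded_word k C (Suc N) l = padded_word k C N (l div k) ** C (l mod k)"

text \<open>Concatenation of the words of \<open>l\<close> and \<open>m\<close>. Digits of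
  \<open>l\<close> beyond the \<open>N\<close>-th are dropped on both sides, so \<open>l\<close> may
  be arbitrary.\<close>

lemma padded_word_append:
  assumes "m < k ^ t"
  shows "padded_word k C (N + t) (l * k ^ t + m) = padded_word k C N l ** padded_word k C t m"
  using assms
proof (induction t arbitrary: m)
  case (Suc t)
  then have k: "k > 0" by (cases k) auto
  have "m div k < k ^ t" using Suc.prems k by (simp add: less_mult_imp_div_less mult.commute)
  moreover have "(l * k ^ Suc t + m) div k = l * k ^ t + m div k"
    using k by (simp add: div_add1_eq mult.left_commute mult.commute)
  moreover have "(l * k ^ Suc t + m) mod k = m mod k"
    by (simp add: mult.left_commute)
  ultimately show ?case using Suc.IH by (simp add: matrix_mul_assoc)
qed simp

lemma padded_word_scale:
  "padded_word k (\<lambda>i. c *\<^sub>R C i) N l = c ^ N *\<^sub>R padded_word k C N l"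
proof (induction N arbitrary: l)
  case (Suc N)
  then show ?case by (simp add: matrix_scalar_ac scalar_matrix_assoc[symmetric] mult.commute)
qed simp

text \<open>Multiplying out the \<open>N\<close>-th power of the sum gives one product for each word
  of \<open>N\<close> digits.\<close>

lemma padded_word_sum:
  assumes "k > 0"
  shows "(\<Sum>l<k ^ N. padded_word k C N l *v y) = ((*v) (\<Sum>i<k. C i) ^^ N) y"
proof (induction N arbitrary: y)
  case (Suc N)
  have "(\<Sum>l<k ^ Suc N. padded_word k C (Suc N) l *v y) =
      (\<Sum>l<k ^ N * k. padded_word k C (Suc N) l *v y)" by (simp add: mult.commute)
  also have "\<dots> = (\<Sum>i<k ^ N. \<Sum>j<k. padded_word k C N i *v (C j *v y))"
    unfolding sum_lessThan_times using assms
    by (intro sum.cong refl) (simp add: matrix_vector_mul_assoc)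
  also have "\<dots> = (\<Sum>i<k ^ N. padded_word k C N i *v ((\<Sum>j<k. C j) *v y))"
    by (simp add: matrix_vector_mult_sum_left matrix_vector_mult_sum_right)
  also have "\<dots> = ((*v) (\<Sum>i<k. C i) ^^ Suc N) y"
    unfolding Suc.IH by (simp add: funpow_swap1)
  finally show ?case .
qed simp

lemma mat_word_append: "mat_word C (ds @ [i]) = mat_word C ds ** C i"
  by (induction ds) (simp_all add: mat_word_def matrix_mul_assoc)

lemma base_digits_0 [simp]: "base_digits k 0 = []"
  by (simp add: base_digits.simps)

lemma base_digits_step: "n > 0 \<Longrightarrow> k \<ge> 2 \<Longrightarrow> base_digits k n = base_digits k (n div k) @ [n mod k]"
  by (subst base_digits.simps) simp

lemma mat_digits_0 [simp]: "mat_digits k C 0 = mat 1"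
  by (simp add: mat_digits_def mat_word_def)

lemma mat_digits_step:
  "n > 0 \<Longrightarrow> k \<ge> 2 \<Longrightarrow> mat_digits k C n = mat_digits k C (n div k) ** C (n mod k)"
  by (simp add: mat_digits_def base_digits_step mat_word_append)

lemma mat_digits_append:
  assumes "k \<ge> 2" "n \<ge> 1" "l < k ^ N"
  shows "mat_digits k C (n * k ^ N + l) = mat_digits k C n ** padded_word k C N l"
  using assms(3)
proof (induction N arbitrary: l)
  case (Suc N)
  have "l div k < k ^ N" using Suc.prems assms(1) by (simp add: less_mult_imp_div_less mult.commute)
  moreover have "(n * k ^ Suc N + l) div k = n * k ^ N + l div k"
    using assms(1) by (simp add: div_add1_eq mult.left_commute mult.commute)
  moreover have "(n * k ^ Suc N + l) mod k = l mod k"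
    by (simp add: mult.left_commute)
  moreover have "n * k ^ Suc N + l > 0" using assms(1,2) by simp
  ultimately show ?case using Suc.IH assms(1)
    by (subst mat_digits_step) (simp_all add: matrix_mul_assoc)
qed simp

lemma less_power_length_base_digits:
  assumes "k \<ge> 2"
  shows "m < k ^ length (base_digits k m)"
proof (induction m rule: less_induct)
  case (less m)
  show ?case
  proof (cases "m = 0")
    case False
    then have "m div k < k ^ length (base_digits k (m div k))"
      using assms by (intro less) auto
    then have "m < k ^ length (base_digits k (m div k)) * k"
      using assms by (simp add: div_less_iff_less_mult)
    then show ?thesis using False assms by (subst base_digits_step) (auto simp: mult.commute)
  qed simp
qed

lemma padded_word_eq_mat_digits:
  assumes "k \<ge> 2" "m < k ^ t"
  shows "padded_word k C t m *v y =
    ((*v) (C 0) ^^ (t - length (base_digits k m))) (mat_digits k C m *v y)"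
  using assms(2)
proof (induction t arbitrary: m y)
  case (Suc t)
  have "m div k < k ^ t" using Suc.prems assms(1) by (simp add: less_mult_imp_div_less mult.commute)
  note IH = Suc.IH[OF this, of "C (m mod k) *v y"]
  show ?case
  proof (cases "m = 0")
    case True
    then show ?thesis
      using IH by (simp add: matrix_vector_mul_assoc[symmetric] funpow_swap1)
  next
    case False
    then show ?thesis
      using IH assms(1)
      by (simp add: matrix_vector_mul_assoc[symmetric] base_digits_step mat_digits_step)
  qed
qed simp

text \<open>The powers of the zeroth matrix in \<open>V_hat\<close> are leading zeros, so the
  generators come from all digit words, with or without leading zeros. In this form, prefixing any
  digit, 0 included, yields another generator; this is the invariance of
  \<open>V_hat\<close>.\<close>

lemma V_hat_padded:
  assumes "k \<ge> 2"
  shows "V_hat k w B x = span {padded_word k (B_tilde k w B) t m *v x |t m. m < k ^ t}"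
proof -
  let ?C = "B_tilde k w B"
  have "{((*v) (?C 0) ^^ n) (mat_digits k ?C m *v x) |m n. True} =
      {padded_word k ?C t m *v x |t m. m < k ^ t}"
  proof (intro equalityI subsetI)
    fix y assume "y \<in> {((*v) (?C 0) ^^ n) (mat_digits k ?C m *v x) |m n. True}"
    then obtain m n where y: "y = ((*v) (?C 0) ^^ n) (mat_digits k ?C m *v x)" by blast
    define t where "t = n + length (base_digits k m)"
    have "m < k ^ length (base_digits k m)" by (rule less_power_length_base_digits[OF assms])
    also have "\<dots> \<le> k ^ t" unfolding t_def using assms by (intro power_increasing) auto
    finally have m: "m < k ^ t" .
    then have "y = padded_word k ?C t m *v x"
      unfolding y by (subst padded_word_eq_mat_digits[OF assms]) (simp_all add: t_def)
    then show "y \<in> {padded_word k ?C t m *v x |t m. m < k ^ t}" using m by blast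
  next
    fix y assume "y \<in> {padded_word k ?C t m *v x |t m. m < k ^ t}"
    then show "y \<in> {((*v) (?C 0) ^^ n) (mat_digits k ?C m *v x) |m n. True}"
      using padded_word_eq_mat_digits[OF assms] by blast
  qed
  then show ?thesis unfolding V_hat_def by simp
qed


section \<open>Matrix-valued measures with finite support\<close>

lemma torus_dirac_shift: "torus_dirac c (torus_shift p A) = torus_dirac (p + c) A"
proof -
  have "frac (p + frac c) = frac (p + c)" by (simp add: frac_unique_iff frac_lt_1)
  then show ?thesis
    by (auto simp: torus_dirac_def torus_shift_def indicator_def frac_lt_1)
qed

lemma poly_at_dirac:
  assumes "A \<in> sets torus"
  shows "poly_at_measure (\<Sum>j<n. monom (c j) j) (torus_dirac y) A =
    (\<Sum>j<n. torus_dirac (real j * y) A *\<^sub>R c j)"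
proof -
  let ?p = "\<Sum>j<n. monom (c j) j"
  have coeff: "coeff ?p j = (if j < n then c j else 0)" for j
    unfolding coeff_sum by (simp add: sum.delta)
  have deg: "j \<le> degree ?p \<or> coeff ?p j = 0" for j
    using coeff_eq_0[of ?p j] by linarith
  have "poly_at_measure ?p (torus_dirac y) A =
      (\<Sum>j\<le>degree ?p. torus_dirac (real j * y) A *\<^sub>R coeff ?p j)"
    unfolding poly_at_measure_def using assms by (simp add: torus_conv_power_dirac)
  \<comment> \<open>Leading coefficients may vanish, so the degree need not be \<open>n - 1\<close>;
    both index ranges are compared with their union.\<close>
  also have "\<dots> = (\<Sum>j\<in>{..degree ?p} \<union> {..<n}. torus_dirac (real j * y) A *\<^sub>R coeff ?p j)"
    using deg by (intro sum.mono_neutral_left) auto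
  also have "\<dots> = (\<Sum>j<n. torus_dirac (real j * y) A *\<^sub>R coeff ?p j)"
    using coeff by (intro sum.mono_neutral_right) auto
  also have "\<dots> = (\<Sum>j<n. torus_dirac (real j * y) A *\<^sub>R c j)"
    using coeff by (intro sum.cong) auto
  finally show ?thesis .
qed

lemma matrix_conv_dirac_sum:
  fixes \<Phi> \<Psi> :: "'d::finite matrix_measure"
  assumes \<Phi>: "\<And>A. A \<in> sets torus \<Longrightarrow> \<Phi> A = (\<Sum>l\<in>I. torus_dirac (p l) A *\<^sub>R M l)"
    and \<Psi>: "\<And>i j. torus_signed (entry \<Psi> i j)" and A: "A \<in> sets torus"
  shows "matrix_conv \<Phi> \<Psi> A = (\<Sum>l\<in>I. M l ** \<Psi> (torus_shift (p l) A))"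
proof -
  have "torus_conv (entry \<Phi> i h) (entry \<Psi> h j) A =
      (\<Sum>l\<in>I. M l $ i $ h * entry \<Psi> h j (torus_shift (p l) A))" for i h j
    by (rule torus_conv_dirac_sum[OF _ \<Psi> A]) (simp add: entry_def \<Phi> mult.commute)
  then have "matrix_conv \<Phi> \<Psi> A $ i $ j =
      (\<Sum>h\<in>UNIV. \<Sum>l\<in>I. M l $ i $ h * \<Psi> (torus_shift (p l) A) $ h $ j)" for i j
    by (simp add: matrix_conv_def entry_def)
  also have "(\<Sum>h\<in>UNIV. \<Sum>l\<in>I. M l $ i $ h * \<Psi> (torus_shift (p l) A) $ h $ j) =
      (\<Sum>l\<in>I. \<Sum>h\<in>UNIV. M l $ i $ h * \<Psi> (torus_shift (p l) A) $ h $ j)" for i j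
    by (rule sum.swap)
  finally show ?thesis
    by (simp add: vec_eq_iff matrix_matrix_mult_def)
qed

lemma entry_dirac_sum:
  fixes \<Phi> :: "'d::finite matrix_measure"
  assumes \<Phi>: "\<And>A. A \<in> sets torus \<Longrightarrow> \<Phi> A = (\<Sum>l\<in>I. torus_dirac (p l) A *\<^sub>R M l)"
  shows "torus_signed (entry \<Phi> i j)"
    and "torus_continuous f \<Longrightarrow> signed_integral (entry \<Phi> i j) f = (\<Sum>l\<in>I. f (p l) * M l $ i $ j)"
proof -
  let ?e = "\<lambda>A. \<Sum>l\<in>I. M l $ i $ j * torus_dirac (p l) A"
  have e: "entry \<Phi> i j A = ?e A" if "A \<in> sets torus" for A
    using \<Phi>[OF that] by (simp add: entry_def mult.commute)
  have s: "torus_signed (\<lambda>A. M l $ i $ j * torus_dirac (p l) A)" for l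
    by (intro torus_signed_scale torus_signed_dirac)
  have "torus_signed ?e" by (rule torus_signed_sum(1)[OF s])
  moreover have "torus_signed (entry \<Phi> i j) \<longleftrightarrow> torus_signed ?e"
    by (rule torus_signed_cong[OF e])
  ultimately show "torus_signed (entry \<Phi> i j)" by simp
  show "signed_integral (entry \<Phi> i j) f = (\<Sum>l\<in>I. f (p l) * M l $ i $ j)" if f: "torus_continuous f"
  proof -
    note b = torus_continuous_bounded[OF f]
    have "signed_integral (entry \<Phi> i j) f = signed_integral ?e f"
      by (rule signed_integral_cong[OF e])
    also have "\<dots> = (\<Sum>l\<in>I. signed_integral (\<lambda>A. M l $ i $ j * torus_dirac (p l) A) f)"
      by (rule torus_signed_sum(2)[OF s b])
    also have "\<dots> = (\<Sum>l\<in>I. f (p l) * M l $ i $ j)"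
      by (simp add: torus_signed_scale(2)[OF torus_signed_dirac(1) b] torus_signed_dirac(2)[OF b]
          torus_continuous_frac[OF f]) (simp add: mult.commute)
    finally show ?thesis .
  qed
qed

lemma refined_fraction:
  fixes l j P Q c :: real
  assumes "P \<noteq> 0" "Q \<noteq> 0" "c \<noteq> 0"
  shows "l / (P * c) + j / (P * Q * c) = (l * Q + j) / (P * Q * c)"
  using assms by (simp add: field_simps)

text \<open>Each further factor appends one digit \<open>j\<close> at the low end: it multiplies by
  \<open>C j\<close> on the right and moves the atom from index \<open>l\<close> of one grid to
  index \<open>l * k + j\<close> of the next finer one.\<close>

lemma matrix_conv_prod_dirac:
  fixes C :: "nat \<Rightarrow> real^'d^'d"
  assumes k: "k \<ge> 2" and A: "A \<in> sets torus"
  shows "matrix_conv_prod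
      (\<lambda>n. poly_at_measure (\<Sum>j<k. monom (C j) j) (torus_dirac (1 / (real k ^ n * (real k - 1))))) N A =
    (\<Sum>l<k ^ N. torus_dirac (real l / (real k ^ N * (real k - 1))) A *\<^sub>R padded_word k C N l)"
  using A
proof (induction N arbitrary: A)
  case 0
  then show ?case by simp
next
  case (Suc N)
  let ?P = "poly_at_measure (\<Sum>j<k. monom (C j) j) (torus_dirac (1 / (real k ^ Suc N * (real k - 1))))"
  let ?y = "1 / (real k ^ Suc N * (real k - 1))"
  have P: "?P A = (\<Sum>j<k. torus_dirac (real j * ?y) A *\<^sub>R C j)" if "A \<in> sets torus" for A
    by (rule poly_at_dirac[OF that])
  have pt: "real l / (real k ^ N * (real k - 1)) + real j * ?y =
      real (l * k + j) / (real k ^ Suc N * (real k - 1))" for l j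
    using k refined_fraction[of "real k ^ N" "real k" "real k - 1" "real l" "real j"]
    by (simp add: mult.commute[of "real k" "real k ^ N"])
  have "matrix_conv_prod (\<lambda>n. poly_at_measure (\<Sum>j<k. monom (C j) j)
      (torus_dirac (1 / (real k ^ n * (real k - 1))))) (Suc N) A =
      (\<Sum>l<k ^ N. padded_word k C N l ** ?P (torus_shift (real l / (real k ^ N * (real k - 1))) A))"
    unfolding matrix_conv_prod.simps
    by (rule matrix_conv_dirac_sum[OF Suc.IH entry_dirac_sum(1)[OF P] Suc.prems])
  also have "\<dots> = (\<Sum>l<k ^ N. \<Sum>j<k.
      torus_dirac (real (l * k + j) / (real k ^ Suc N * (real k - 1))) A *\<^sub>R (padded_word k C N l ** C j))"
    unfolding P[OF torus_shift_sets[OF Suc.prems]] torus_dirac_shift pt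
    by (simp only: matrix_mult_sum_right matrix_scalar_ac scalar_matrix_assoc)
  also have "\<dots> = (\<Sum>l<k ^ N. \<Sum>j<k.
      torus_dirac (real (l * k + j) / (real k ^ Suc N * (real k - 1))) A *\<^sub>R padded_word k C (Suc N) (l * k + j))"
    using k by (intro sum.cong refl) simp
  also have "\<dots> = (\<Sum>l<k ^ N * k.
      torus_dirac (real l / (real k ^ Suc N * (real k - 1))) A *\<^sub>R padded_word k C (Suc N) l)"
    by (rule sum_lessThan_times[symmetric])
  finally show ?case by (simp only: power_Suc2)
qed


section \<open>Convergence under refinement\<close>

lemma grid_point_in_torus:
  assumes "k \<ge> 2" "l < k ^ N"
  shows "real l / (real k ^ N * (real k - 1)) \<in> {0..<1}"
proof -
  have "real l < real k ^ N" using assms(2) by (metis of_nat_less_iff of_nat_power)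
  also have "\<dots> \<le> real k ^ N * (real k - 1)" using assms(1) by simp
  finally show ?thesis using assms(1) by simp
qed

lemma refinement_convergent:
  fixes p :: "nat \<Rightarrow> nat \<Rightarrow> real"
  assumes k: "k \<ge> 2" and p: "\<And>N l. l < k ^ N \<Longrightarrow> p N l \<ge> 0"
    and K: "\<And>N. (\<Sum>l<k ^ N. p N l) \<le> K"
    and tail: "\<And>N l. l < k ^ N \<Longrightarrow> convergent (\<lambda>L. \<Sum>j<k ^ L. p (N + L) (l * k ^ L + j))"
    and f: "torus_continuous f"
  shows "convergent (\<lambda>N. \<Sum>l<k ^ N. f (real l / (real k ^ N * (real k - 1))) * p N l)"
proof -
  define pt where "pt N l = real l / (real k ^ N * (real k - 1))" for N l
  define \<alpha> where "\<alpha> N = (\<Sum>l<k ^ N. f (pt N l) * p N l)" for N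
  define \<beta> where "\<beta> N L = (\<Sum>l<k ^ N. f (pt N l) * (\<Sum>j<k ^ L. p (N + L) (l * k ^ L + j)))" for N L
  have K0: "K \<ge> 0" using K[of 0] p[of 0 0] by simp
  have "Cauchy \<alpha>"
  proof (rule metric_CauchyI)
    fix \<epsilon> :: real assume \<epsilon>: "\<epsilon> > 0"
    \<comment> \<open>The oscillation of \<open>f\<close> will be weighted by a total mass of at
      most \<open>K\<close>; the added 1 covers \<open>K = 0\<close>.\<close>
    define \<eta> where "\<eta> = \<epsilon> / (3 * (K + 1))"
    have \<eta>: "\<eta> > 0" "\<eta> * K < \<epsilon> / 3"
      using \<epsilon> K0 by (simp_all add: \<eta>_def field_simps)
    obtain \<delta> where \<delta>: "\<delta> > 0"
      "\<And>s t. s \<in> {0..1} \<Longrightarrow> t \<in> {0..1} \<Longrightarrow> \<bar>s - t\<bar> < \<delta> \<Longrightarrow> \<bar>f s - f t\<bar> < \<eta>"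
      using torus_continuous_uniform[OF f \<eta>(1)] by blast
    obtain N where N: "(1 / real k) ^ N < \<delta>"
      using real_arch_pow_inv[OF \<delta>(1), of "1 / real k"] k by auto
    (* Freeze f on the cylinders of level N; what remains is the mass of each cylinder, which converges. *)
    have close: "\<bar>\<alpha> (N + L) - \<beta> N L\<bar> \<le> \<eta> * K" for L
    proof -
      have "\<alpha> (N + L) = (\<Sum>l<k ^ N. \<Sum>j<k ^ L. f (pt (N + L) (l * k ^ L + j)) * p (N + L) (l * k ^ L + j))"
        unfolding \<alpha>_def power_add sum_lessThan_times ..
      then have diff: "\<alpha> (N + L) - \<beta> N L = (\<Sum>l<k ^ N. \<Sum>j<k ^ L.
          (f (pt (N + L) (l * k ^ L + j)) - f (pt N l)) * p (N + L) (l * k ^ L + j))"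
        by (simp add: \<beta>_def sum_distrib_left sum_subtractf left_diff_distrib)
      have "\<bar>\<alpha> (N + L) - \<beta> N L\<bar> \<le> (\<Sum>l<k ^ N. \<Sum>j<k ^ L. \<eta> * p (N + L) (l * k ^ L + j))"
        unfolding diff
      proof (intro order_trans[OF sum_abs] sum_mono)
        fix l j assume l: "l \<in> {..<k ^ N}" and j: "j \<in> {..<k ^ L}"
        have lj: "l * k ^ L + j < k ^ (N + L)"
          using l j by (simp add: power_add mult_add_less)
        have "pt (N + L) (l * k ^ L + j) - pt N l = pt (N + L) j"
          using k refined_fraction[of "real k ^ N" "real k ^ L" "real k - 1" "real l" "real j"]
          by (simp add: pt_def power_add)
        moreover have "\<bar>pt (N + L) j\<bar> \<le> (1 / real k) ^ N"
        proof -
          have "pt L j \<in> {0..<1}" unfolding pt_def using j by (intro grid_point_in_torus[OF k]) auto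
          \<comment> \<open>The grid of level \<open>N + L\<close> inside a cylinder of level
            \<open>N\<close> is a copy of the grid of level \<open>L\<close>, scaled by the
            \<open>N\<close>-th power of \<open>1 / k\<close>.\<close>
          moreover have "pt (N + L) j = (1 / real k) ^ N * pt L j"
            by (simp add: pt_def power_add power_divide)
          ultimately show ?thesis using k by (simp add: abs_mult mult_left_le)
        qed
        ultimately have "\<bar>pt (N + L) (l * k ^ L + j) - pt N l\<bar> < \<delta>" using N by simp
        \<comment> \<open>No atom wraps around, so uniform continuity on the unit interval
          suffices.\<close>
        moreover have "pt (N + L) (l * k ^ L + j) \<in> {0..1}" "pt N l \<in> {0..1}"
          using grid_point_in_torus[OF k lj] grid_point_in_torus[OF k, of l N] l by (auto simp: pt_def)
        ultimately have "\<bar>f (pt (N + L) (l * k ^ L + j)) - f (pt N l)\<bar> \<le> \<eta>"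
          using \<delta>(2) by (simp add: less_imp_le)
        then show "\<bar>(f (pt (N + L) (l * k ^ L + j)) - f (pt N l)) * p (N + L) (l * k ^ L + j)\<bar>
            \<le> \<eta> * p (N + L) (l * k ^ L + j)"
          using p[OF lj] by (simp add: abs_mult mult_right_mono)
      qed
      also have "\<dots> = \<eta> * (\<Sum>l<k ^ (N + L). p (N + L) l)"
        by (simp add: power_add sum_lessThan_times sum_distrib_left)
      also have "\<dots> \<le> \<eta> * K" using \<eta>(1) K by (intro mult_left_mono) auto
      finally show ?thesis .
    qed
    have "convergent (\<beta> N)"
    proof -
      define c where "c l = lim (\<lambda>L. \<Sum>j<k ^ L. p (N + L) (l * k ^ L + j))" for l
      have c: "(\<lambda>L. \<Sum>j<k ^ L. p (N + L) (l * k ^ L + j)) \<longlonglongrightarrow> c l" if "l < k ^ N" for l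
        using tail[OF that] unfolding c_def convergent_LIMSEQ_iff .
      have "\<beta> N \<longlonglongrightarrow> (\<Sum>l<k ^ N. f (pt N l) * c l)"
        unfolding \<beta>_def[abs_def] using c by (intro tendsto_sum tendsto_mult tendsto_const) auto
      then show ?thesis unfolding convergent_def by blast
    qed
    then have "Cauchy (\<beta> N)" by (simp add: Cauchy_convergent_iff)
    then obtain L0 where L0: "\<And>L L'. L \<ge> L0 \<Longrightarrow> L' \<ge> L0 \<Longrightarrow> dist (\<beta> N L) (\<beta> N L') < \<epsilon> / 3"
      using \<epsilon> unfolding Cauchy_def by (metis zero_less_divide_iff zero_less_numeral)
    show "\<exists>M. \<forall>m\<ge>M. \<forall>n\<ge>M. dist (\<alpha> m) (\<alpha> n) < \<epsilon>"
    proof (intro exI[of _ "N + L0"] allI impI)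
      fix m n assume "m \<ge> N + L0" "n \<ge> N + L0"
      then have m: "m = N + (m - N)" "m - N \<ge> L0" and n: "n = N + (n - N)" "n - N \<ge> L0" by auto
      have "\<bar>\<alpha> m - \<beta> N (m - N)\<bar> < \<epsilon> / 3" "\<bar>\<alpha> n - \<beta> N (n - N)\<bar> < \<epsilon> / 3"
        using close[of "m - N"] close[of "n - N"] m(1) n(1) \<eta>(2) by simp_all
      then show "dist (\<alpha> m) (\<alpha> n) < \<epsilon>"
        using L0[OF m(2) n(2)] unfolding dist_real_def by linarith
    qed
  qed
  then have "convergent \<alpha>" by (simp add: Cauchy_convergent_iff)
  then show ?thesis unfolding \<alpha>_def[abs_def] pt_def .
qed


section \<open>Orthogonal projections\<close>

lemma orth_proj:
  assumes "subspace V"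
  shows orth_proj_in: "orth_proj V *v y \<in> V"
    and orth_proj_inner: "v \<in> V \<Longrightarrow> v \<bullet> (orth_proj V *v y) = v \<bullet> y"
    and orth_proj_id: "v \<in> V \<Longrightarrow> orth_proj V *v v = v"
proof -
  have P: "\<forall>y. orth_proj V *v y \<in> V \<and> (\<forall>v\<in>V. orthogonal (y - orth_proj V *v y) v)"
    unfolding orth_proj_def by (rule theI'[OF ex1_orth_proj[OF assms]])
  then show in_V: "orth_proj V *v y \<in> V" for y by blast
  show inner: "v \<bullet> (orth_proj V *v y) = v \<bullet> y" if "v \<in> V" for v y
  proof -
    have "v \<bullet> (y - orth_proj V *v y) = 0"
      using P that unfolding orthogonal_def by (simp add: inner_commute)
    then show ?thesis by (simp add: inner_diff_right)
  qed
  show "orth_proj V *v v = v" if v: "v \<in> V"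
  proof -
    have d: "v - orth_proj V *v v \<in> V" using v in_V assms by (simp add: subspace_diff)
    have "(v - orth_proj V *v v) \<bullet> (v - orth_proj V *v v) = 0"
      unfolding inner_diff_right using inner[OF d] by (simp add: inner_diff_right)
    then show ?thesis by simp
  qed
qed

section \<open>Reduced representations\<close>

locale reduced =
  fixes k :: nat and w x :: "real^'d" and B :: "nat \<Rightarrow> real^'d^'d" and g :: "nat \<Rightarrow> real"
  assumes k: "k \<ge> 2" and reduced: "reduced_representation k w B x g"
begin

abbreviation "V \<equiv> row_space k w B"
abbreviation "W \<equiv> V_hat k w B x"
abbreviation "Bt \<equiv> B_tilde k w B"
abbreviation "Bs \<equiv> B_tilde_sum k w B"
abbreviation "Bh \<equiv> B_hat k w B x"
abbreviation "\<rho> \<equiv> growth k w B"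
abbreviation "C \<equiv> (\<lambda>i. (1 / \<rho>) *\<^sub>R Bh i)"

lemma g_eq: "g n = w \<bullet> (mat_digits k B n *v x)"
  using reduced unfolding reduced_representation_def linear_representation_def by blast

lemma g_nonneg: "g n \<ge> 0"
  using reduced unfolding reduced_representation_def by blast

lemma rho_pos: "\<rho> > 0"
  and peripheral: "z \<in> eigenvalues Bs \<Longrightarrow> cmod z = \<rho> \<Longrightarrow> z = complex_of_real \<rho>"
  and eigen_x: "Bs *v x = \<rho> *\<^sub>R x"
  and block_sum_g: "block_sum k g n = \<rho> ^ n"
  using reduced unfolding reduced_representation_def Let_def by blast+

lemma subspace_V: "subspace V"
  unfolding row_space_def by (rule subspace_span)

lemma subspace_W: "subspace W"
  unfolding V_hat_def by (rule subspace_span)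

lemma Bt_apply: "Bt i *v y = orth_proj V *v (B i *v (orth_proj V *v y))"
  by (simp add: B_tilde_def compress_def matrix_vector_mul_assoc[symmetric])

lemma Bs_eq: "Bs = (\<Sum>i<k. Bt i)"
  by (simp add: B_tilde_sum_def B_tilde_def compress_def matrix_mult_sum_left matrix_mult_sum_right)

lemma Bt_in_V: "Bt i *v y \<in> V"
  unfolding Bt_apply by (rule orth_proj_in[OF subspace_V])

lemma Bs_in_V: "Bs *v y \<in> V"
  unfolding Bs_eq matrix_vector_mult_sum_left
  by (intro subspace_sum subspace_V Bt_in_V)

text \<open>An eigenvector for a nonzero eigenvalue lies in the range of \<open>Bs\<close>, hence in
  \<open>V\<close>.\<close>

lemma x_in_V: "x \<in> V"
proof -
  have "(1 / \<rho>) *\<^sub>R (Bs *v x) \<in> V" by (intro subspace_scale subspace_V Bs_in_V)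
  then show ?thesis using rho_pos by (simp add: eigen_x)
qed

text \<open>Multiplication on the right appends the digit \<open>i\<close>, turning the generator
  for \<open>n\<close> into the one for \<open>n * k + i\<close>.\<close>

lemma V_mult_B:
  assumes "u \<in> V" "i < k" shows "u v* B i \<in> V"
  using assms(1) unfolding row_space_def
proof (induction rule: span_induct_alt)
  case base
  then show ?case by (simp add: span_zero)
next
  case (step c y z)
  then obtain n where n: "y = w v* mat_digits k B n" "n \<ge> 1" by blast
  have "y v* B i = w v* mat_digits k B (n * k + i)"
    using mat_digits_append[OF k n(2), of i 1 B] assms(2)
    by (simp add: n(1) vector_matrix_mul_assoc)
  moreover have "n * k + i \<ge> 1" using n(2) k by (simp add: Suc_le_eq)
  ultimately have "y v* B i \<in> span {w v* mat_digits k B n |n. n \<ge> 1}"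
    by (intro span_base) blast
  then show ?case
    using step(2) unfolding vector_matrix_left_distrib scaleR_vector_matrix_assoc
    by (intro span_add span_scale)
qed

lemma V_mult_word: "u \<in> V \<Longrightarrow> u v* padded_word k B N l \<in> V"
proof (induction N arbitrary: l)
  case (Suc N)
  then show ?case using k by (simp add: vector_matrix_mul_assoc[symmetric] V_mult_B)
qed simp

text \<open>Tested against a row of \<open>V\<close>, both projections in \<open>Bt\<close>
  disappear: the outer one because \<open>u\<close> is in \<open>V\<close>, the inner one because
  \<open>u v* B i\<close> is in \<open>V\<close> again.\<close>

lemma inner_Bt:
  assumes "u \<in> V" "i < k" shows "u \<bullet> (Bt i *v y) = u \<bullet> (B i *v y)"
proof -
  have "u \<bullet> (Bt i *v y) = (u v* B i) \<bullet> (orth_proj V *v y)"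
    unfolding Bt_apply orth_proj_inner[OF subspace_V assms(1)] dot_lmul_matrix ..
  also have "\<dots> = (u v* B i) \<bullet> y"
    by (rule orth_proj_inner[OF subspace_V V_mult_B[OF assms]])
  also have "\<dots> = u \<bullet> (B i *v y)"
    by (rule dot_lmul_matrix)
  finally show ?thesis .
qed

lemma inner_Bt_word:
  assumes "u \<in> V" shows "u \<bullet> (padded_word k Bt N l *v y) = u \<bullet> (padded_word k B N l *v y)"
proof (induction N arbitrary: l y)
  case (Suc N)
  have "u \<bullet> (padded_word k Bt (Suc N) l *v y) = (u v* padded_word k B N (l div k)) \<bullet> (Bt (l mod k) *v y)"
    by (simp add: matrix_vector_mul_assoc[symmetric] Suc.IH dot_lmul_matrix)
  also have "\<dots> = (u v* padded_word k B N (l div k)) \<bullet> (B (l mod k) *v y)"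
    using k by (intro inner_Bt V_mult_word assms) simp
  finally show ?case by (simp add: matrix_vector_mul_assoc[symmetric] dot_lmul_matrix)
qed simp

lemma W_eq: "W = span {padded_word k Bt t m *v x |t m. m < k ^ t}"
  by (rule V_hat_padded[OF k])

text \<open>Multiplication on the left prefixes the digit \<open>i\<close> to a word of length
  \<open>t\<close>, which adds \<open>i * k ^ t\<close> to its index.\<close>

lemma Bt_in_W:
  assumes "v \<in> W" "i < k" shows "Bt i *v v \<in> W"
  using assms(1) unfolding W_eq
proof (induction rule: span_induct_alt)
  case base
  then show ?case by (simp add: span_zero)
next
  case (step c y z)
  then obtain t m where m: "y = padded_word k Bt t m *v x" "m < k ^ t" by blast
  have "Bt i *v y = padded_word k Bt (1 + t) (i * k ^ t + m) *v x"
    using padded_word_append[OF m(2), of Bt 1 i] assms(2)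
    by (simp add: m(1) matrix_vector_mul_assoc)
  moreover have "i * k ^ t + m < k ^ (1 + t)"
    using mult_add_less[OF assms(2) m(2)] by simp
  ultimately have "Bt i *v y \<in> span {padded_word k Bt t m *v x |t m. m < k ^ t}"
    by (intro span_base) blast
  then show ?case
    using step(2) unfolding matrix_vector_right_distrib matrix_vector_mult_scaleR
    by (intro span_add span_scale)
qed

text \<open>Lets rows from \<open>V\<close> separate the vectors of \<open>W\<close>, and lets
  projections onto \<open>W\<close> serve as rows in \<open>V\<close>.\<close>

lemma W_subset_V: "W \<subseteq> V"
  unfolding W_eq
proof (intro span_minimal subspace_V subsetI)
  fix y assume "y \<in> {padded_word k Bt t m *v x |t m. m < k ^ t}"
  then obtain t m where y: "y = padded_word k Bt t m *v x" by blast
  have "padded_word k Bt t m *v z \<in> V" if "z \<in> V" for z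
    using that by (induction t arbitrary: m z) (simp_all add: matrix_vector_mul_assoc[symmetric] Bt_in_V)
  then show "y \<in> V" using x_in_V y by simp
qed

lemma Bh_apply:
  assumes "v \<in> W" "i < k" shows "Bh i *v v = Bt i *v v"
  using assms Bt_in_W[OF assms]
  by (simp add: B_hat_def compress_def matrix_vector_mul_assoc[symmetric] orth_proj_id[OF subspace_W])

lemma Bh_proj: "Bh i *v (orth_proj W *v y) = Bh i *v y"
  by (simp add: B_hat_def compress_def matrix_vector_mul_assoc[symmetric]
      orth_proj_id[OF subspace_W] orth_proj_in[OF subspace_W])

lemma C_word_apply:
  assumes "v \<in> W"
  shows "padded_word k C N l *v v = (1 / \<rho>) ^ N *\<^sub>R (padded_word k Bt N l *v v)"
    and "padded_word k C N l *v v \<in> W"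
proof -
  have "padded_word k Bh N l *v v = padded_word k Bt N l *v v \<and> padded_word k Bt N l *v v \<in> W"
    using assms
  proof (induction N arbitrary: l v)
    case (Suc N)
    have i: "l mod k < k" using k by simp
    show ?case
      using Suc.IH[OF Bt_in_W[OF Suc.prems i]]
      by (simp add: matrix_vector_mul_assoc[symmetric] Bh_apply[OF Suc.prems i])
  qed simp
  then show "padded_word k C N l *v v = (1 / \<rho>) ^ N *\<^sub>R (padded_word k Bt N l *v v)"
    and "padded_word k C N l *v v \<in> W"
    by (simp_all add: padded_word_scale scaleR_matrix_vector_assoc[symmetric] subspace_scale[OF subspace_W])
qed

lemma C_sum_power:
  assumes "v \<in> W"
  shows "(\<Sum>l<k ^ N. padded_word k C N l *v v) = (1 / \<rho>) ^ N *\<^sub>R (((*v) Bs ^^ N) v)"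
  unfolding C_word_apply(1)[OF assms] scaleR_sum_right[symmetric] Bs_eq
  using k by (subst padded_word_sum) auto

text \<open>The sandwiched word is, up to scaling, a value of \<open>g\<close>: this is where positivity and the mass
  bounds for the entries of the convolution product come from.\<close>

lemma word_value:
  assumes "n \<ge> 1" "l < k ^ N" "m < k ^ t"
  shows "(w v* mat_digits k B n) \<bullet> (padded_word k C N l *v (padded_word k Bt t m *v x)) =
    (1 / \<rho>) ^ N * g ((n * k ^ N + l) * k ^ t + m)"
proof -
  let ?u = "w v* mat_digits k B n"
  have u: "?u \<in> V" unfolding row_space_def using assms(1) by (intro span_base) blast
  have v: "padded_word k Bt t m *v x \<in> W" unfolding W_eq using assms(3) by (intro span_base) blast
  have nl: "n * k ^ N + l \<ge> 1" using assms(1) k by (simp add: Suc_le_eq)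
  have "?u \<bullet> (padded_word k Bt N l *v (padded_word k Bt t m *v x)) =
      ?u \<bullet> (padded_word k Bt (N + t) (l * k ^ t + m) *v x)"
    by (simp add: padded_word_append[OF assms(3)] matrix_vector_mul_assoc)
  also have "\<dots> = ?u \<bullet> (padded_word k B (N + t) (l * k ^ t + m) *v x)"
    by (rule inner_Bt_word[OF u])
  also have "\<dots> = w \<bullet> (mat_digits k B ((n * k ^ N + l) * k ^ t + m) *v x)"
    by (simp add: padded_word_append[OF assms(3)] mat_digits_append[OF k nl assms(3)]
        mat_digits_append[OF k assms(1,2)] dot_lmul_matrix matrix_vector_mul_assoc matrix_mul_assoc)
  finally show ?thesis by (simp add: C_word_apply(1)[OF v] g_eq)
qed

lemma word_value_nonneg:
  assumes "n \<ge> 1" "l < k ^ N" "m < k ^ t"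
  shows "(w v* mat_digits k B n) \<bullet> (padded_word k C N l *v (padded_word k Bt t m *v x)) \<ge> 0"
  unfolding word_value[OF assms] using g_nonneg rho_pos by simp

text \<open>Numbers with prefix \<open>n\<close>, suffix \<open>m\<close> and \<open>N\<close> free
  digits in between are distinct and have the same number of digits, so they lie in one block, whose
  sum is a power of \<open>\<rho>\<close>. The factor \<open>(1 / \<rho>) ^ N\<close> cancels the
  part that depends on \<open>N\<close>.\<close>

lemma word_value_sum_bounded:
  assumes "n \<ge> 1" "m < k ^ t"
  shows "\<exists>K. \<forall>N. (\<Sum>l<k ^ N. (w v* mat_digits k B n) \<bullet>
    (padded_word k C N l *v (padded_word k Bt t m *v x))) \<le> K"
proof -
  \<comment> \<open>\<open>s + 1\<close> is the number of digits of \<open>n\<close>.\<close>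
  obtain s where s: "k ^ s \<le> n" "n < k ^ (s + 1)" using ex_power_ivl1[OF k assms(1)] by blast
  have "(\<Sum>l<k ^ N. (w v* mat_digits k B n) \<bullet>
    (padded_word k C N l *v (padded_word k Bt t m *v x))) \<le> \<rho> ^ (s + t)" for N
  proof -
    define h where "h l = (n * k ^ N + l) * k ^ t + m" for l
    have inj: "inj_on h {..<k ^ N}" using k by (auto simp: inj_on_def h_def)
    have "h l \<in> {k ^ (s + N + t)..<k ^ (s + N + t + 1)}" if "l < k ^ N" for l
    proof -
      have "k ^ (s + N + t) \<le> n * k ^ N * k ^ t"
        unfolding power_add using s(1) by (intro mult_right_mono) auto
      also have "\<dots> \<le> h l" by (simp add: h_def add_mult_distrib)
      finally have 1: "k ^ (s + N + t) \<le> h l" .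
      have "n * k ^ N + l < k ^ (s + 1) * k ^ N" using mult_add_less[OF s(2) that] .
      then have "h l < k ^ (s + 1) * k ^ N * k ^ t"
        unfolding h_def using assms(2) by (rule mult_add_less)
      then show ?thesis using 1 by (simp add: power_add ac_simps)
    qed
    then have sub: "h ` {..<k ^ N} \<subseteq> {k ^ (s + N + t)..<k ^ (s + N + t + 1)}" by blast
    have "(\<Sum>l<k ^ N. g (h l)) = sum g (h ` {..<k ^ N})" using inj by (simp add: sum.reindex)
    also have "\<dots> \<le> (\<Sum>m = k ^ (s + N + t)..<k ^ (s + N + t + 1). g m)"
      using sub g_nonneg by (intro sum_mono2) auto
    also have "\<dots> = \<rho> ^ (s + N + t)" using block_sum_g unfolding block_sum_def .
    finally have "(1 / \<rho>) ^ N * (\<Sum>l<k ^ N. g (h l)) \<le> (1 / \<rho>) ^ N * \<rho> ^ (s + N + t)"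
      using rho_pos by (intro mult_left_mono) auto
    also have "\<dots> = \<rho> ^ (s + t)" using rho_pos by (simp add: power_add power_divide)
    finally have "(1 / \<rho>) ^ N * (\<Sum>l<k ^ N. g (h l)) \<le> \<rho> ^ (s + t)" .
    then show ?thesis by (simp add: word_value[OF assms(1) _ assms(2)] h_def sum_distrib_left)
  qed
  then show ?thesis by blast
qed

text \<open>By \<open>C_sum_power\<close> the pairing is a sum over all words. For generators its
  terms are nonnegative, so the upper bound on the sum also bounds the absolute value; the general
  case follows by linearity, first in \<open>v\<close> and then in \<open>u\<close>.\<close>

lemma Bs_powers_bounded_inner:
  assumes u: "u \<in> V" and v: "v \<in> W"
  shows "\<exists>K. \<forall>N. \<bar>u \<bullet> ((1 / \<rho>) ^ N *\<^sub>R (((*v) Bs ^^ N) v))\<bar> \<le> K"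
proof -
  define b where "b u v N = u \<bullet> (\<Sum>l<k ^ N. padded_word k C N l *v v)" for u v N
  have "\<exists>K. \<forall>N. \<bar>b u v N\<bar> \<le> K"
    using u unfolding row_space_def
  proof (induction rule: span_induct_alt)
    case base
    then show ?case by (auto simp: b_def)
  next
    case (step c u' z)
    then obtain n where n: "u' = w v* mat_digits k B n" "n \<ge> 1" by blast
    have "\<exists>K. \<forall>N. \<bar>b u' v N\<bar> \<le> K"
      using v unfolding W_eq
    proof (induction rule: span_induct_alt)
      case base
      then show ?case by (auto simp: b_def)
    next
      case (step a v' y)
      then obtain t m where v': "v' = padded_word k Bt t m *v x" and m: "m < k ^ t" by blast
      obtain K1 where K1: "\<And>N. \<bar>b u' y N\<bar> \<le> K1" using step(2) by blast
      obtain K2 where K2: "\<And>N. b u' v' N \<le> K2"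
        using word_value_sum_bounded[OF n(2) m] unfolding b_def n(1) v' inner_sum_right by blast
      have "b u' v' N \<ge> 0" for N
        unfolding b_def n(1) v' inner_sum_right
        using word_value_nonneg[OF n(2) _ m] by (intro sum_nonneg) auto
      moreover have "b u' (a *\<^sub>R v' + y) N = a * b u' v' N + b u' y N" for N
        by (simp add: b_def matrix_vector_right_distrib matrix_vector_mult_scaleR sum.distrib
            inner_add_right scaleR_sum_right[symmetric])
      ultimately have "\<bar>b u' (a *\<^sub>R v' + y) N\<bar> \<le> \<bar>a\<bar> * K2 + K1" for N
        using K1[of N] K2[of N] mult_left_mono[of "b u' v' N" K2 "\<bar>a\<bar>"]
        by (simp add: abs_mult abs_triangle_ineq[THEN order_trans] add_mono)
      then show ?case by blast
    qed
    then obtain K1 where K1: "\<And>N. \<bar>b u' v N\<bar> \<le> K1" by blast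
    obtain K2 where K2: "\<And>N. \<bar>b z v N\<bar> \<le> K2" using step(2) by blast
    have "b (c *\<^sub>R u' + z) v N = c * b u' v N + b z v N" for N
      by (simp add: b_def inner_add_left)
    then have "\<bar>b (c *\<^sub>R u' + z) v N\<bar> \<le> \<bar>c\<bar> * K1 + K2" for N
      using K1[of N] K2[of N] mult_left_mono[of "\<bar>b u' v N\<bar>" K1 "\<bar>c\<bar>"]
      by (simp add: abs_mult abs_triangle_ineq[THEN order_trans] add_mono)
    then show ?case by blast
  qed
  then show ?thesis unfolding b_def C_sum_power[OF v] .
qed

text \<open>On \<open>V\<close> the \<open>i\<close>-th coordinate is the pairing with the
  projection of \<open>axis i 1\<close> onto \<open>V\<close>. The bounds on pairings thus bound
  each coordinate of the orbit.\<close>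

lemma Bs_powers_converge:
  assumes v: "v \<in> W"
  shows "convergent (\<lambda>N. ((1 / \<rho>) ^ N *\<^sub>R (((*v) Bs ^^ N) v)) $ i)"
proof -
  have inV: "((*v) Bs ^^ N) v \<in> V" for N
    using v W_subset_V Bs_in_V by (induction N) auto
  have comp: "((1 / \<rho>) ^ N *\<^sub>R (((*v) Bs ^^ N) v)) $ i = (((*v) Bs ^^ N) v) $ i / \<rho> ^ N" for N i
    by (simp add: power_divide)
  have "\<exists>K. \<forall>N. \<bar>(((*v) Bs ^^ N) v) $ i / \<rho> ^ N\<bar> \<le> K" for i
  proof -
    have proj: "axis i 1 \<bullet> y = (orth_proj V *v axis i 1) \<bullet> y" if "y \<in> V" for y :: "real^'d"
      using orth_proj_inner[OF subspace_V that, of "axis i 1"] by (simp add: inner_commute)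
    then have "(((*v) Bs ^^ N) v) $ i / \<rho> ^ N =
        (orth_proj V *v axis i 1) \<bullet> ((1 / \<rho>) ^ N *\<^sub>R (((*v) Bs ^^ N) v))" for N
    proof -
      have z: "(1 / \<rho>) ^ N *\<^sub>R (((*v) Bs ^^ N) v) \<in> V"
        by (intro subspace_scale subspace_V inV)
      show ?thesis using proj[OF z] unfolding inner_axis' comp by simp
    qed
    then show ?thesis
      using Bs_powers_bounded_inner[OF orth_proj_in[OF subspace_V] v] by simp
  qed
  then show ?thesis
    unfolding comp using convergent_normalized_powers[of Bs v i] rho_pos peripheral
    unfolding growth_def by blast
qed

text \<open>The integral of \<open>f\<close> against the scalar measure obtained by putting
  \<open>u\<close> and \<open>v\<close> on both sides of the \<open>N\<close>-th convolution
  product.\<close>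

definition grid_sum :: "real^'d \<Rightarrow> real^'d \<Rightarrow> (real \<Rightarrow> real) \<Rightarrow> nat \<Rightarrow> real" where
  "grid_sum u v f N =
     (\<Sum>l<k ^ N. f (real l / (real k ^ N * (real k - 1))) * (u \<bullet> (padded_word k C N l *v v)))"

lemma grid_sum_limit_generators:
  assumes "n \<ge> 1" "m < k ^ t"
  shows "\<exists>\<nu>. torus_signed \<nu> \<and> (\<forall>f. torus_continuous f \<longrightarrow>
    grid_sum (w v* mat_digits k B n) (padded_word k Bt t m *v x) f \<longlonglongrightarrow> signed_integral \<nu> f)"
proof -
  let ?u = "w v* mat_digits k B n" and ?v = "padded_word k Bt t m *v x"
  define p where "p N l = ?u \<bullet> (padded_word k C N l *v ?v)" for N l
  have v: "?v \<in> W" unfolding W_eq using assms(2) by (intro span_base) blast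
  have p0: "p N l \<ge> 0" if "l < k ^ N" for N l
    unfolding p_def using word_value_nonneg[OF assms(1) that assms(2)] .
  obtain K where K: "\<And>N. (\<Sum>l<k ^ N. p N l) \<le> K"
    using word_value_sum_bounded[OF assms] unfolding p_def by blast
  \<comment> \<open>The refinements of \<open>l\<close> run over all suffixes \<open>j\<close>, and
    summing over these turns the suffix into the normalised power \<open>?y L\<close>. The mass is
    therefore a fixed linear functional of a convergent sequence of vectors.\<close>
  have tail: "convergent (\<lambda>L. \<Sum>j<k ^ L. p (N + L) (l * k ^ L + j))" for N l
  proof -
    let ?y = "\<lambda>L. (1 / \<rho>) ^ L *\<^sub>R (((*v) Bs ^^ L) ?v)"
    have eq: "(\<Sum>j<k ^ L. p (N + L) (l * k ^ L + j)) =
        (\<Sum>a\<in>UNIV. (?u v* padded_word k C N l) $ a * ?y L $ a)" for L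
    proof -
      have "(\<Sum>j<k ^ L. p (N + L) (l * k ^ L + j)) =
          (\<Sum>j<k ^ L. (?u v* padded_word k C N l) \<bullet> (padded_word k C L j *v ?v))"
        by (intro sum.cong refl)
          (simp add: p_def padded_word_append matrix_vector_mul_assoc[symmetric] dot_lmul_matrix)
      also have "\<dots> = (?u v* padded_word k C N l) \<bullet> ?y L"
        unfolding inner_sum_right[symmetric] C_sum_power[OF v] ..
      finally show ?thesis by (simp add: inner_vec_def)
    qed
    define c where "c a = lim (\<lambda>L. ?y L $ a)" for a
    have c: "(\<lambda>L. ?y L $ a) \<longlonglongrightarrow> c a" for a
      using Bs_powers_converge[OF v, of a] unfolding c_def convergent_LIMSEQ_iff .
    have "(\<lambda>L. \<Sum>a\<in>UNIV. (?u v* padded_word k C N l) $ a * ?y L $ a) \<longlonglongrightarrow>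
        (\<Sum>a\<in>UNIV. (?u v* padded_word k C N l) $ a * c a)"
      by (intro tendsto_sum tendsto_mult tendsto_const c)
    then show ?thesis unfolding eq convergent_def by blast
  qed
  obtain \<nu> where "torus_signed \<nu>" "\<And>f. torus_continuous f \<Longrightarrow>
      (\<lambda>N. \<Sum>l<k ^ N. f (real l / (real k ^ N * (real k - 1))) * p N l) \<longlonglongrightarrow> signed_integral \<nu> f"
    by (rule discrete_torus_measures_limit[where n = "\<lambda>N. k ^ N" and p = p and K = K
          and pt = "\<lambda>N l. real l / (real k ^ N * (real k - 1))",
          OF p0 K grid_point_in_torus[OF k] refinement_convergent[OF k p0 K tail]]) blast+
  then show ?thesis unfolding p_def grid_sum_def[abs_def] by blast
qed

text \<open>The limits for generators are combined with arbitrary real coefficients, so only the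
  existence of a signed limit is carried along, not positivity.\<close>

lemma grid_sum_limit:
  assumes u: "u \<in> V" and v: "v \<in> W"
  shows "\<exists>\<nu>. torus_signed \<nu> \<and> (\<forall>f. torus_continuous f \<longrightarrow> grid_sum u v f \<longlonglongrightarrow> signed_integral \<nu> f)"
  using u unfolding row_space_def
proof (induction rule: span_induct_alt)
  case base
  have "grid_sum 0 v f = (\<lambda>_. 0)" for f by (simp add: grid_sum_def fun_eq_iff)
  then show ?case
    using torus_signed_zero torus_continuous_bounded by (intro exI[of _ "\<lambda>A. 0"]) simp
next
  case (step c u' z)
  then obtain n where n: "u' = w v* mat_digits k B n" "n \<ge> 1" by blast
  have "\<exists>\<nu>. torus_signed \<nu> \<and> (\<forall>f. torus_continuous f \<longrightarrow> grid_sum u' v f \<longlonglongrightarrow> signed_integral \<nu> f)"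
    using v unfolding W_eq
  proof (induction rule: span_induct_alt)
    case base
    have "grid_sum u' 0 f = (\<lambda>_. 0)" for f by (simp add: grid_sum_def fun_eq_iff)
    then show ?case
      using torus_signed_zero torus_continuous_bounded by (intro exI[of _ "\<lambda>A. 0"]) simp
  next
    case (step a v' y)
    then obtain t m where v': "v' = padded_word k Bt t m *v x" and m: "m < k ^ t" by blast
    obtain \<nu>1 where 1: "torus_signed \<nu>1"
      "\<And>f. torus_continuous f \<Longrightarrow> grid_sum u' v' f \<longlonglongrightarrow> signed_integral \<nu>1 f"
      using grid_sum_limit_generators[OF n(2) m] unfolding n(1) v' by blast
    obtain \<nu>2 where 2: "torus_signed \<nu>2"
      "\<And>f. torus_continuous f \<Longrightarrow> grid_sum u' y f \<longlonglongrightarrow> signed_integral \<nu>2 f"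
      using step(2) by blast
    have "grid_sum u' (a *\<^sub>R v' + y) f = (\<lambda>N. a * grid_sum u' v' f N + grid_sum u' y f N)" for f
      by (simp add: fun_eq_iff grid_sum_def matrix_vector_right_distrib matrix_vector_mult_scaleR
          inner_add_right sum_distrib_left sum.distrib[symmetric] algebra_simps)
    then show ?case
      using torus_signed_lincomb[OF 1(1) 2(1), where c = a] 1(2) 2(2)
      by (intro exI[of _ "\<lambda>A. a * \<nu>1 A + \<nu>2 A"]) (auto intro!: tendsto_intros)
  qed
  then obtain \<nu>1 where 1: "torus_signed \<nu>1"
    "\<And>f. torus_continuous f \<Longrightarrow> grid_sum u' v f \<longlonglongrightarrow> signed_integral \<nu>1 f" by blast
  obtain \<nu>2 where 2: "torus_signed \<nu>2"
    "\<And>f. torus_continuous f \<Longrightarrow> grid_sum z v f \<longlonglongrightarrow> signed_integral \<nu>2 f"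
    using step(2) by blast
  have "grid_sum (c *\<^sub>R u' + z) v f = (\<lambda>N. c * grid_sum u' v f N + grid_sum z v f N)" for f
    by (simp add: fun_eq_iff grid_sum_def inner_add_left
        sum_distrib_left sum.distrib[symmetric] algebra_simps)
  then show ?case
    using torus_signed_lincomb[OF 1(1) 2(1), where c = c] 1(2) 2(2)
    by (intro exI[of _ "\<lambda>A. c * \<nu>1 A + \<nu>2 A"]) (auto intro!: tendsto_intros)
qed

text \<open>A nonempty product begins and ends with a matrix compressed to \<open>W\<close>, so
  projecting the basis vectors on both sides changes nothing. For \<open>N = 0\<close> the product
  is \<open>mat 1\<close>, where this may fail.\<close>

lemma entry_proj:
  assumes "N \<ge> 1"
  shows "padded_word k C N l $ i $ j =
    (orth_proj W *v axis i 1) \<bullet> (padded_word k C N l *v (orth_proj W *v axis j 1))"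
proof -
  obtain N' where N: "N = Suc N'" using assms by (cases N) auto
  have W: "orth_proj W *v y \<in> W" for y by (rule orth_proj_in[OF subspace_W])
  have "padded_word k C N l *v (orth_proj W *v axis j 1) = padded_word k C N l *v axis j 1"
    by (simp add: N matrix_vector_mul_assoc[symmetric] scaleR_matrix_vector_assoc[symmetric] Bh_proj)
  moreover have "padded_word k C N l $ i $ j = axis i 1 \<bullet> (padded_word k C N l *v axis j 1)"
    by (simp add: matrix_vector_mult_basis column_def inner_axis' )
  moreover have "y \<bullet> z = (orth_proj W *v y) \<bullet> z" if "z \<in> W" for y z
    using orth_proj_inner[OF subspace_W that, of y] by (simp add: inner_commute)
  ultimately show ?thesis using C_word_apply(2)[OF W] by metis
qed

text \<open>The projected basis vectors lie in \<open>W\<close>; the left one is used as a row,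
  which is legitimate since \<open>W\<close> is contained in \<open>V\<close>.\<close>

lemma entry_limit:
  "\<exists>\<nu>. torus_signed \<nu> \<and> (\<forall>f. torus_continuous f \<longrightarrow>
    (\<lambda>N. \<Sum>l<k ^ N. f (real l / (real k ^ N * (real k - 1))) * padded_word k C N l $ i $ j)
      \<longlonglongrightarrow> signed_integral \<nu> f)"
proof -
  let ?u = "orth_proj W *v axis i 1" and ?v = "orth_proj W *v axis j 1"
  have "?v \<in> W" "?u \<in> V" using orth_proj_in[OF subspace_W] W_subset_V by blast+
  then obtain \<nu> where \<nu>: "torus_signed \<nu>"
    "\<And>f. torus_continuous f \<Longrightarrow> grid_sum ?u ?v f \<longlonglongrightarrow> signed_integral \<nu> f"
    using grid_sum_limit by blast
  have "(\<lambda>N. \<Sum>l<k ^ N. f (real l / (real k ^ N * (real k - 1))) * padded_word k C N l $ i $ j)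
      \<longlonglongrightarrow> signed_integral \<nu> f" if f: "torus_continuous f" for f
  proof (rule Lim_transform_eventually[OF \<nu>(2)[OF f]])
    show "\<forall>\<^sub>F N in sequentially. grid_sum ?u ?v f N =
        (\<Sum>l<k ^ N. f (real l / (real k ^ N * (real k - 1))) * padded_word k C N l $ i $ j)"
      using eventually_ge_at_top[of 1]
      by eventually_elim (simp add: grid_sum_def entry_proj[symmetric])
  qed
  then show ?thesis using \<nu>(1) by blast
qed

text \<open>Write \<open>m = j * k ^ N + l\<close>. Then \<open>k ^ N + m\<close> has the nonzero
  leading digit \<open>Suc j\<close>, followed by the \<open>N\<close> digits of \<open>l\<close>.
  The leading digit accounts for the coefficient \<open>B (Suc j)\<close> and for the shift by
  \<open>j / (k - 1)\<close>, the remaining digits for the convolution product.\<close>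

lemma ghost_approx_integral:
  assumes f: "torus_continuous f"
  shows "(\<integral>t. f t \<partial>ghost_approx k g N) =
    (\<Sum>j<k - 1. grid_sum (w v* B (Suc j)) x (\<lambda>t. f (real j * (1 / (real k - 1)) + t)) N)"
proof -
  let ?pt = "\<lambda>m. real m / (real k ^ N * (real k - 1))"
  let ?h = "\<lambda>m. ennreal (g (k ^ N + m) / block_sum k g N)"
  have card: "k ^ (N + 1) - k ^ N = (k - 1) * k ^ N"
    by (simp add: diff_mult_distrib)
  have fm: "f \<in> borel_measurable torus"
    using torus_continuous_bounded[OF f] by (simp add: torus_bounded_def)
  have ptm: "?pt \<in> point_measure {..<k ^ (N + 1) - k ^ N} ?h \<rightarrow>\<^sub>M torus"
  proof -
    have "?pt m \<in> {0..<1}" if "m < (k - 1) * k ^ N" for m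
    proof -
      have "real m < real ((k - 1) * k ^ N)" using that by (simp only: of_nat_less_iff)
      also have "\<dots> = real k ^ N * (real k - 1)" using k by (simp add: of_nat_diff mult.commute)
      finally show ?thesis using k by simp
    qed
    then show ?thesis unfolding card by (auto simp: point_measure_def)
  qed
  have "(\<integral>t. f t \<partial>ghost_approx k g N) = (\<integral>m. f (?pt m) \<partial>point_measure {..<k ^ (N + 1) - k ^ N} ?h)"
    unfolding ghost_approx_def by (rule integral_distr[OF ptm fm])
  also have "\<dots> = (\<Sum>m<(k - 1) * k ^ N. g (k ^ N + m) / block_sum k g N * f (?pt m))"
    unfolding card using g_nonneg rho_pos
    by (subst lebesgue_integral_point_measure_finite) (simp_all add: block_sum_g)
  also have "\<dots> = (\<Sum>j<k - 1. \<Sum>l<k ^ N. g (k ^ N + (j * k ^ N + l)) / block_sum k g N * f (?pt (j * k ^ N + l)))"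
    by (rule sum_lessThan_times)
  also have "\<dots> = (\<Sum>j<k - 1. grid_sum (w v* B (Suc j)) x (\<lambda>t. f (real j * (1 / (real k - 1)) + t)) N)"
    unfolding grid_sum_def
  proof (intro sum.cong refl)
    fix j l assume j: "j \<in> {..<k - 1}" and l: "l \<in> {..<k ^ N}"
    have jk: "Suc j < k" using j by auto
    have "mat_digits k B (Suc j) = B (Suc j)"
      using k jk by (subst mat_digits_step) simp_all
    \<comment> \<open>The suffix is the empty word (\<open>m = 0\<close>, \<open>t = 0\<close>),
      which leaves the vector \<open>x\<close> itself.\<close>
    then have "(w v* B (Suc j)) \<bullet> (padded_word k C N l *v x) = (1 / \<rho>) ^ N * g (Suc j * k ^ N + l)"
      using word_value[of "Suc j" l N 0 0] l by simp
    moreover have "?pt (j * k ^ N + l) = real j * (1 / (real k - 1)) + ?pt l"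
      using k by (simp add: add_divide_distrib)
    ultimately show "g (k ^ N + (j * k ^ N + l)) / block_sum k g N * f (?pt (j * k ^ N + l)) =
        f (real j * (1 / (real k - 1)) + ?pt l) * ((w v* B (Suc j)) \<bullet> (padded_word k C N l *v x))"
      by (simp add: block_sum_g power_divide ac_simps)
  qed
  finally show ?thesis .
qed

end

section \<open>The ghost measure as an infinite convolution\<close>

lemma B_diff_poly_eq: "B_diff_poly k B = (\<Sum>j<k - 1. monom (B (Suc j)) j)"
  unfolding B_diff_poly_def
  by (rule sum.reindex_bij_witness[of _ Suc "\<lambda>j. j - 1"]) auto

theorem proposition7:
  fixes k :: nat and w x :: "real^'d" and B :: "nat \<Rightarrow> real^'d^'d"
    and g :: "nat \<Rightarrow> real" and \<mu>\<^sub>g :: "real measure"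
  assumes "k \<ge> 2"
    and "reduced_representation k w B x g"
    and "ghost_measure k g \<mu>\<^sub>g"
  shows "\<exists>\<Lambda> :: 'd matrix_measure.
           torus_vector_measure \<Lambda> \<and>
           matrix_weak_limit
             (matrix_conv_prod
                (\<lambda>n. poly_at_measure (B_hat_poly k w B x) (torus_dirac (1 / (real k ^ n * (real k - 1))))))
             \<Lambda> \<and>
           (\<forall>A\<in>sets torus.
              measure \<mu>\<^sub>g A =
                w \<bullet> (matrix_conv (poly_at_measure (B_diff_poly k B) (torus_dirac (1 / (real k - 1)))) \<Lambda> A *v x))"
proof -
  interpret reduced k w x B g by unfold_locales (use assms in auto)
  have k: "k \<ge> 2" by fact
  define is_limit where "is_limit i j \<nu> \<longleftrightarrow> torus_signed \<nu> \<and> (\<forall>f. torus_continuous f \<longrightarrow>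
      (\<lambda>N. \<Sum>l<k ^ N. f (real l / (real k ^ N * (real k - 1))) * padded_word k C N l $ i $ j)
        \<longlonglongrightarrow> signed_integral \<nu> f)" for i j \<nu>
  define \<nu> where "\<nu> i j = (SOME \<nu>. is_limit i j \<nu>)" for i j
  have lim: "is_limit i j (\<nu> i j)" for i j
  proof -
    have "\<exists>\<nu>. is_limit i j \<nu>" unfolding is_limit_def by (rule entry_limit)
    then show ?thesis unfolding \<nu>_def by (rule someI_ex)
  qed
  have \<nu>s: "torus_signed (\<nu> i j)" for i j
    using lim[of i j] unfolding is_limit_def by blast
  have \<nu>: "(\<lambda>N. \<Sum>l<k ^ N. f (real l / (real k ^ N * (real k - 1))) * padded_word k C N l $ i $ j)
      \<longlonglongrightarrow> signed_integral (\<nu> i j) f" if "torus_continuous f" for i j f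
    using lim[of i j] that unfolding is_limit_def by blast
  define \<Lambda> :: "'d matrix_measure" where "\<Lambda> A = (\<chi> i j. \<nu> i j A)" for A
  have entry: "entry \<Lambda> i j = \<nu> i j" for i j by (simp add: entry_def \<Lambda>_def fun_eq_iff)
  have vm: "torus_vector_measure \<Lambda>"
    unfolding torus_vector_measure_def
  proof (intro allI impI, elim conjE)
    fix A :: "nat \<Rightarrow> real set" assume A: "range A \<subseteq> sets torus" "disjoint_family A"
    have "(\<lambda>n. \<nu> i j (A n)) sums \<nu> i j (\<Union>n. A n)" for i j
      using torus_signed_imp_vector_measure[OF \<nu>s[of i j]] A unfolding torus_vector_measure_def by blast
    then show "(\<lambda>n. \<Lambda> (A n)) sums \<Lambda> (\<Union>n. A n)"
      unfolding sums_def by (intro vec_tendstoI) (simp add: \<Lambda>_def)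
  qed
  have wl: "matrix_weak_limit (matrix_conv_prod
      (\<lambda>n. poly_at_measure (B_hat_poly k w B x) (torus_dirac (1 / (real k ^ n * (real k - 1)))))) \<Lambda>"
    unfolding matrix_weak_limit_def B_hat_poly_def
  proof (intro allI impI)
    fix i j f assume f: "torus_continuous f"
    have "signed_integral (entry (matrix_conv_prod
        (\<lambda>n. poly_at_measure (\<Sum>j<k. monom (C j) j) (torus_dirac (1 / (real k ^ n * (real k - 1))))) N) i j) f =
        (\<Sum>l<k ^ N. f (real l / (real k ^ N * (real k - 1))) * padded_word k C N l $ i $ j)" for N
      by (rule entry_dirac_sum(2)[OF matrix_conv_prod_dirac[OF k] f])
    then show "(\<lambda>N. signed_integral (entry (matrix_conv_prod
        (\<lambda>n. poly_at_measure (\<Sum>j<k. monom (C j) j) (torus_dirac (1 / (real k ^ n * (real k - 1))))) N) i j) f)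
        \<longlonglongrightarrow> signed_integral (entry \<Lambda> i j) f"
      using \<nu>[OF f] by (simp only: entry)
  qed
  let ?\<Psi> = "poly_at_measure (B_diff_poly k B) (torus_dirac (1 / (real k - 1)))"
  let ?c = "\<lambda>j. real j * (1 / (real k - 1))"
  \<comment> \<open>The right-hand side of the claim, expanded into translates of the entries of the
    limit. In this form its integrals are those of shifted test functions against the entries, so it
    is a weak limit.\<close>
  define \<tau> where "\<tau> A = (\<Sum>j<k - 1. \<Sum>a\<in>UNIV. \<Sum>b\<in>UNIV.
      ((w v* B (Suc j)) $ a * x $ b) * \<nu> a b (torus_shift (?c j) A))" for A
  have \<tau>: "w \<bullet> (matrix_conv ?\<Psi> \<Lambda> A *v x) = \<tau> A" if A: "A \<in> sets torus" for A
  proof -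
    have conv: "matrix_conv ?\<Psi> \<Lambda> A = (\<Sum>j<k - 1. B (Suc j) ** \<Lambda> (torus_shift (?c j) A))"
    proof (rule matrix_conv_dirac_sum[OF _ _ A])
      show "?\<Psi> A = (\<Sum>j<k - 1. torus_dirac (?c j) A *\<^sub>R B (Suc j))" if "A \<in> sets torus" for A
        unfolding B_diff_poly_eq by (rule poly_at_dirac[OF that])
      show "torus_signed (entry \<Lambda> i j)" for i j unfolding entry by (rule \<nu>s)
    qed
    have "w \<bullet> ((B (Suc j) ** D) *v x) = (\<Sum>a\<in>UNIV. \<Sum>b\<in>UNIV. ((w v* B (Suc j)) $ a * x $ b) * D $ a $ b)"
      for j and D :: "real^'d^'d"
    proof -
      have "w \<bullet> ((B (Suc j) ** D) *v x) = (w v* B (Suc j)) \<bullet> (D *v x)"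
        by (simp add: dot_lmul_matrix matrix_vector_mul_assoc)
      then show ?thesis
        by (simp add: inner_vec_def matrix_vector_mult_def sum_distrib_left ac_simps)
    qed
    then show ?thesis
      by (simp add: conv \<tau>_def matrix_vector_mult_sum_left inner_sum_right \<Lambda>_def)
  qed
  note scale = torus_signed_scale[OF torus_signed_shift(1)[OF \<nu>s]]
  have ts: "torus_signed \<tau>"
    unfolding \<tau>_def[abs_def] by (intro torus_signed_sum(1) scale(1))
  have int_\<tau>: "(\<lambda>N. \<integral>t. f t \<partial>ghost_approx k g N) \<longlonglongrightarrow> signed_integral \<tau> f" if f: "torus_continuous f" for f
  proof -
    note b = torus_continuous_bounded[OF f]
    let ?f = "\<lambda>j t. f (?c j + t)"
    have "signed_integral \<tau> f = (\<Sum>j<k - 1. \<Sum>a\<in>UNIV. \<Sum>b\<in>UNIV.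
        ((w v* B (Suc j)) $ a * x $ b) * signed_integral (\<nu> a b) (?f j))"
      unfolding \<tau>_def[abs_def]
      by (simp add: torus_signed_sum(2)[OF _ b] torus_signed_sum(1) scale(1) scale(2)[OF b]
          torus_signed_shift(2)[OF \<nu>s b] torus_continuous_frac[OF f])
    moreover have "grid_sum (w v* B (Suc j)) x (?f j) \<longlonglongrightarrow> (\<Sum>a\<in>UNIV. \<Sum>b\<in>UNIV.
        ((w v* B (Suc j)) $ a * x $ b) * signed_integral (\<nu> a b) (?f j))" for j
    proof -
      have eq: "grid_sum u y h N = (\<Sum>a\<in>UNIV. \<Sum>b\<in>UNIV. (u $ a * y $ b) *
          (\<Sum>l<k ^ N. h (real l / (real k ^ N * (real k - 1))) * padded_word k C N l $ a $ b))" for u y h N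
      proof -
        let ?t = "\<lambda>l a b. (u $ a * y $ b) * (h (real l / (real k ^ N * (real k - 1))) * padded_word k C N l $ a $ b)"
        have "grid_sum u y h N = (\<Sum>l<k ^ N. \<Sum>a\<in>UNIV. \<Sum>b\<in>UNIV. ?t l a b)"
          unfolding grid_sum_def
          by (simp only: inner_vec_def matrix_vector_mult_def vec_lambda_beta sum_distrib_left inner_real_def ac_simps)
        also have "\<dots> = (\<Sum>a\<in>UNIV. \<Sum>l<k ^ N. \<Sum>b\<in>UNIV. ?t l a b)" by (rule sum.swap)
        also have "\<dots> = (\<Sum>a\<in>UNIV. \<Sum>b\<in>UNIV. \<Sum>l<k ^ N. ?t l a b)"
          by (intro sum.cong refl sum.swap)
        finally show ?thesis by (simp only: sum_distrib_left)
      qed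
      show ?thesis
        unfolding eq[abs_def]
        by (intro tendsto_sum tendsto_mult tendsto_const \<nu> torus_continuous_shift f)
    qed
    ultimately show ?thesis
      unfolding ghost_approx_integral[OF f] by (simp only:) (intro tendsto_sum)
  qed
  have \<mu>: "prob_space \<mu>\<^sub>g" "sets \<mu>\<^sub>g = sets torus"
    using assms(3) unfolding ghost_measure_def by blast+
  \<comment> \<open>The whole sequence of approximants converges to \<open>\<tau>\<close>, so an
    accumulation point has the same integrals. The neighbourhood used is given by the single
    function \<open>f\<close> and half the supposed gap.\<close>
  have int_eq: "signed_integral \<tau> f = (\<integral>t. f t \<partial>\<mu>\<^sub>g)" if f: "torus_continuous f" for f
  proof (rule ccontr)
    let ?I = "\<integral>t. f t \<partial>\<mu>\<^sub>g"
    assume "signed_integral \<tau> f \<noteq> ?I"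
    then have e: "\<bar>signed_integral \<tau> f - ?I\<bar> / 2 > 0" (is "?e > 0") by simp
    have "\<exists>\<^sub>F N in sequentially. \<bar>(\<integral>t. f t \<partial>ghost_approx k g N) - ?I\<bar> < ?e"
      using assms(3) f e unfolding ghost_measure_def
      by (auto dest!: spec[of _ "{f}"] spec[of _ ?e] elim!: frequently_elim1)
    moreover have "\<forall>\<^sub>F N in sequentially. \<bar>(\<integral>t. f t \<partial>ghost_approx k g N) - signed_integral \<tau> f\<bar> < ?e"
      using int_\<tau>[OF f] e unfolding tendsto_iff dist_real_def by blast
    ultimately have "\<exists>\<^sub>F N in sequentially. \<bar>(\<integral>t. f t \<partial>ghost_approx k g N) - ?I\<bar> < ?e \<and>
        \<bar>(\<integral>t. f t \<partial>ghost_approx k g N) - signed_integral \<tau> f\<bar> < ?e"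
      by (rule frequently_eventually_frequently)
    then obtain N where "\<bar>(\<integral>t. f t \<partial>ghost_approx k g N) - ?I\<bar> < ?e"
        "\<bar>(\<integral>t. f t \<partial>ghost_approx k g N) - signed_integral \<tau> f\<bar> < ?e"
      using frequently_ex by blast
    moreover have "\<bar>signed_integral \<tau> f - ?I\<bar> \<le> \<bar>(\<integral>t. f t \<partial>ghost_approx k g N) - ?I\<bar> +
        \<bar>(\<integral>t. f t \<partial>ghost_approx k g N) - signed_integral \<tau> f\<bar>"
      using abs_triangle_ineq4[of "(\<integral>t. f t \<partial>ghost_approx k g N) - ?I"
          "(\<integral>t. f t \<partial>ghost_approx k g N) - signed_integral \<tau> f"] by simp
    ultimately show False by argo
  qed
  have "measure \<mu>\<^sub>g A = w \<bullet> (matrix_conv ?\<Psi> \<Lambda> A *v x)" if A: "A \<in> sets torus" for A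
    unfolding \<tau>[OF A]
    using torus_signed_eqI[OF ts prob_space.finite_measure[OF \<mu>(1)] \<mu>(2) int_eq A] .
  then show ?thesis using vm wl by blast
qed

end
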